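(* Let $\mathbb{F}_q$ be a finite field of characteristic two, let $\nu\ge 1$, $n=2\nu+1$, $$S=S_{2\nu+1}=\begin{pmatrix}0&I^{(\nu)}&\\ I^{(\nu)}&0&\\ &&1\end{pmatrix}$$ (blank entries are zero), and $$Ps_n(\mathbb{F}_q,S)=\{\,T\in\mathrm{GL}_n(\mathbb{F}_q): T\,S\,{}^tT=S\,\}.$$ Let $$P_{n-1,k}=(X_1,\ldots,X_{n-1})\begin{pmatrix}0&I^{(\nu)}\\ I^{(\nu)}&0\end{pmatrix}\begin{pmatrix}X_1^{q^k}\\ \vdots\\ X_{n-1}^{q^k}\end{pmatrix},\quad k=1,2,\ldots.$$ Then $$\mathbb{F}_q(X_1,\ldots,X_n)^{Ps_n(\mathbb{F}_q,S)}=\mathbb{F}_q(P_{n-1,1},\ldots,P_{n-1,n-1},X_n).$$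
   Context: ${}^tT$ is the transpose of $T$; $I^{(\nu)}$ is the $\nu\times\nu$ identity matrix. Action: each $T\in\mathrm{GL}_n(\mathbb{F}_q)$ induces the $\mathbb{F}_q$-automorphism $\sigma_T$ of the rational function field $\mathbb{F}_q(X_1,\ldots,X_n)$ given by $\sigma_T(f(X_1,\ldots,X_n))=f(\sigma_T(X_1),\ldots,\sigma_T(X_n))$ with $(\sigma_T(X_1),\ldots,\sigma_T(X_n))=(X_1,\ldots,X_n)T$. For a subgroup $H\le \mathrm{GL}_n(\mathbb{F}_q)$, $\mathbb{F}_q(X_1,\ldots,X_n)^{H}=\{f:\sigma_T(f)=f\text{ for all }T\in H\}$. *)

theory Defs
  imports
    "HOL-Library.Poly_Mapping"
    "HOL-Library.Cardinality"
    "HOL-Computational_Algebra.Fraction_Field"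
    "HOL-Computational_Algebra.Polynomial_Factorial"
    "HOL-Algebra.Algebraic_Closure_Type"
    "HOL-Algebra.Generated_Fields"
    "Jordan_Normal_Form.Matrix"
begin

text \<open>
  Polynomials over \<open>'a\<close> in variables indexed by \<^typ>\<open>nat\<close>: a monomial is a finitely supported
  exponent vector, a polynomial is a finitely supported family of coefficients. The polynomial ring
  has infinitely many variables, and \<open>F(X\<^sub>1, \<dots>, X\<^sub>n)\<close> is the subfield of its fraction field generated
  by \<open>F\<close> and the first \<open>n\<close> variables. Indices start at 0, as for matrices: \<open>Xvar i\<close> is the variable
  that is usually written with index \<open>i + 1\<close>.
\<close>

type_synonym 'a mpol = "(nat \<Rightarrow>\<^sub>0 nat) \<Rightarrow>\<^sub>0 'a"
type_synonym 'a ratfun = "'a mpol fract"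

definition Cpol :: "'a :: field \<Rightarrow> 'a mpol" where
  "Cpol c = Poly_Mapping.single 0 c"

definition Xpol :: "nat \<Rightarrow> 'a :: field mpol" where
  "Xpol i = Poly_Mapping.single (Poly_Mapping.single i 1) 1"

definition Const :: "'a :: field \<Rightarrow> 'a ratfun" where
  "Const c = to_fract (Cpol c)"

definition Xvar :: "nat \<Rightarrow> 'a :: field ratfun" where
  "Xvar i = to_fract (Xpol i)"

text \<open>\<open>adjoin A\<close> is the field \<open>F(A)\<close>, where the field \<open>F\<close> of constants is the type \<open>'a\<close>.\<close>

definition adjoin :: "'a :: field ratfun set \<Rightarrow> 'a ratfun set" where
  "adjoin A = generate_field ring_of_type_algebra (range Const \<union> A)"

definition ratfun_field :: "nat \<Rightarrow> 'a :: field ratfun set" where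
  "ratfun_field n = adjoin (Xvar ` {..<n})"

text \<open>
  \<open>mpol_eval c g p\<close> is the value of \<open>p\<close> with coefficients mapped by \<open>c\<close> and the variable with
  index \<open>i\<close> replaced by \<open>g i\<close>.
\<close>

definition mpol_eval :: "('a :: field \<Rightarrow> 'b :: comm_ring_1) \<Rightarrow> (nat \<Rightarrow> 'b) \<Rightarrow> 'a mpol \<Rightarrow> 'b" where
  "mpol_eval c g p =
     (\<Sum>m\<in>Poly_Mapping.keys p. c (Poly_Mapping.lookup p m) *
        (\<Prod>i\<in>Poly_Mapping.keys m. g i ^ Poly_Mapping.lookup m i))"

definition GL :: "nat \<Rightarrow> 'a :: field mat set" where
  "GL n = {T \<in> carrier_mat n n. invertible_mat T}"

text \<open>
  The images of the variables are the entries of the row vector \<open>(X\<^sub>1, \<dots>, X\<^sub>n) T\<close>; variables with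
  larger indices, which do not occur in \<open>F(X\<^sub>1, \<dots>, X\<^sub>n)\<close>, are left fixed.
\<close>

definition var_image :: "'a :: field mat \<Rightarrow> nat \<Rightarrow> 'a ratfun" where
  "var_image T j =
     (if j < dim_col T
      then (mat 1 (dim_row T) (\<lambda>(_, i). Xvar i) * map_mat Const T) $$ (0, j)
      else Xvar j)"

text \<open>
  The action substitutes \<open>var_image T\<close> in numerator and denominator. For invertible \<open>T\<close> the result
  does not depend on the fraction that is chosen, see \<open>sigma_Fract\<close> below.
\<close>

definition sigma :: "'a :: field mat \<Rightarrow> 'a ratfun \<Rightarrow> 'a ratfun" where
  "sigma T f =
     (THE y. \<exists>a b. b \<noteq> 0 \<and> f = Fraction_Field.Fract a b \<and>
        y = mpol_eval Const (var_image T) a / mpol_eval Const (var_image T) b)"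

definition invariant_field :: "nat \<Rightarrow> 'a :: field mat set \<Rightarrow> 'a ratfun set" where
  "invariant_field n H = {f \<in> ratfun_field n. \<forall>T\<in>H. sigma T f = f}"

definition Jmat :: "nat \<Rightarrow> 'a :: {zero, one} mat" where
  "Jmat \<nu> = four_block_mat (0\<^sub>m \<nu> \<nu>) (1\<^sub>m \<nu>) (1\<^sub>m \<nu>) (0\<^sub>m \<nu> \<nu>)"

definition Smat :: "nat \<Rightarrow> 'a :: {zero, one} mat" where
  "Smat \<nu> = four_block_mat (Jmat \<nu>) (0\<^sub>m (2 * \<nu>) 1) (0\<^sub>m 1 (2 * \<nu>)) (1\<^sub>m 1)"

text \<open>The pseudo-symplectic group of a symmetric matrix \<open>S\<close>.\<close>

definition Ps :: "nat \<Rightarrow> 'a :: field mat \<Rightarrow> 'a mat set" where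
  "Ps n S = {T \<in> GL n. T * S * transpose_mat T = S}"

text \<open>
  \<open>Ppol \<nu> k\<close> is the form usually written with first index \<open>2\<nu>\<close> (that is, \<open>n - 1\<close> for \<open>n = 2\<nu> + 1\<close>);
  the \<open>1 \<times> 1\<close> matrix product is identified with its entry, and \<open>q = CARD('a)\<close>.
\<close>

definition Ppol :: "nat \<Rightarrow> nat \<Rightarrow> 'a :: {field, finite} ratfun" where
  "Ppol \<nu> k =
     (mat 1 (2 * \<nu>) (\<lambda>(_, i). Xvar i) * Jmat \<nu> *
      mat (2 * \<nu>) 1 (\<lambda>(i, _). Xvar i ^ (CARD('a) ^ k))) $$ (0, 0)"

subsection \<open>The action is well defined\<close>

definition monom_eval :: "(nat \<Rightarrow> 'b :: comm_ring_1) \<Rightarrow> (nat \<Rightarrow>\<^sub>0 nat) \<Rightarrow> 'b" where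
  "monom_eval g m = (\<Prod>i\<in>Poly_Mapping.keys m. g i ^ Poly_Mapping.lookup m i)"

lemma monom_eval_superset:
  assumes "finite A" "Poly_Mapping.keys m \<subseteq> A"
  shows "monom_eval g m = (\<Prod>i\<in>A. g i ^ Poly_Mapping.lookup m i)"
  unfolding monom_eval_def
  by (rule prod.mono_neutral_left) (use assms in \<open>auto simp: in_keys_iff\<close>)

lemma monom_eval_add: "monom_eval g (m + m') = monom_eval g m * monom_eval g m'"
proof -
  let ?A = "Poly_Mapping.keys m \<union> Poly_Mapping.keys m'"
  have "monom_eval g (m + m') = (\<Prod>i\<in>?A. g i ^ Poly_Mapping.lookup (m + m') i)"
    by (rule monom_eval_superset) (auto dest: subsetD[OF Poly_Mapping.keys_add])
  also have "\<dots> = (\<Prod>i\<in>?A. g i ^ Poly_Mapping.lookup m i) * (\<Prod>i\<in>?A. g i ^ Poly_Mapping.lookup m' i)"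
    by (simp add: lookup_add power_add prod.distrib)
  also have "\<dots> = monom_eval g m * monom_eval g m'"
    by (simp add: monom_eval_superset[of ?A])
  finally show ?thesis .
qed

locale coeff_hom =
  fixes c :: "'a :: field \<Rightarrow> 'b :: comm_ring_1"
  assumes c_add: "c (x + y) = c x + c y"
    and c_mult: "c (x * y) = c x * c y"
    and c_one: "c 1 = 1"
begin

lemma c_zero: "c 0 = 0"
  using c_add[of 0 0] by simp

lemma eval_single: "mpol_eval c g (Poly_Mapping.single m a) = c a * monom_eval g m"
  by (simp add: mpol_eval_def monom_eval_def c_zero)

lemma eval_zero: "mpol_eval c g 0 = 0"
  by (simp add: mpol_eval_def)

lemma eval_add: "mpol_eval c g (p + r) = mpol_eval c g p + mpol_eval c g r"
  unfolding mpol_eval_def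
  by (rule setsum_keys_plus_distrib) (simp_all add: c_zero c_add distrib_right)

lemma eval_sum: "mpol_eval c g (sum f A) = (\<Sum>x\<in>A. mpol_eval c g (f x))"
  by (induction A rule: infinite_finite_induct) (simp_all add: eval_zero eval_add)

lemma mpol_sum_single:
  fixes p :: "'a mpol"
  shows "p = (\<Sum>m\<in>Poly_Mapping.keys p. Poly_Mapping.single m (Poly_Mapping.lookup p m))"
  by (rule poly_mapping_eqI)
     (simp add: lookup_sum lookup_single when_def in_keys_iff)

lemma eval_mult: "mpol_eval c g (p * r) = mpol_eval c g p * mpol_eval c g r"
proof -
  have "mpol_eval c g (p * r) = mpol_eval c g
      ((\<Sum>m\<in>Poly_Mapping.keys p. Poly_Mapping.single m (Poly_Mapping.lookup p m)) *
       (\<Sum>m\<in>Poly_Mapping.keys r. Poly_Mapping.single m (Poly_Mapping.lookup r m)))"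
    using mpol_sum_single[of p] mpol_sum_single[of r] by simp
  also have "\<dots> = (\<Sum>m\<in>Poly_Mapping.keys p. mpol_eval c g (Poly_Mapping.single m (Poly_Mapping.lookup p m))) *
       (\<Sum>m\<in>Poly_Mapping.keys r. mpol_eval c g (Poly_Mapping.single m (Poly_Mapping.lookup r m)))"
    by (simp add: sum_product eval_sum mult_single eval_single c_mult monom_eval_add mult_ac)
  also have "\<dots> = mpol_eval c g p * mpol_eval c g r"
    by (simp only: eval_sum[symmetric] mpol_sum_single[symmetric])
  finally show ?thesis .
qed

lemma eval_Cpol: "mpol_eval c g (Cpol a) = c a"
  by (simp add: Cpol_def eval_single monom_eval_def)

lemma eval_one: "mpol_eval c g 1 = 1"
  using eval_Cpol[of g 1] by (simp add: Cpol_def c_one)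

lemma eval_Xpol: "mpol_eval c g (Xpol i) = g i"
  by (simp add: Xpol_def eval_single monom_eval_def c_one)

lemma eval_power: "mpol_eval c g (p ^ k) = mpol_eval c g p ^ k"
  by (induction k) (simp_all add: eval_one eval_mult)

lemma eval_prod: "mpol_eval c g (prod f A) = (\<Prod>x\<in>A. mpol_eval c g (f x))"
  by (induction A rule: infinite_finite_induct) (simp_all add: eval_one eval_mult)

lemma eval_eval:
  "mpol_eval c g (mpol_eval Cpol h p) = mpol_eval c (\<lambda>i. mpol_eval c g (h i)) p"
  by (simp add: mpol_eval_def[of Cpol] mpol_eval_def[of c "\<lambda>i. mpol_eval c g (h i)"]
        eval_sum eval_mult eval_Cpol eval_prod eval_power)

end

interpretation Cpol: coeff_hom Cpol
  by standard (simp_all add: Cpol_def single_add mult_single)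

interpretation Const: coeff_hom Const
  by standard (simp_all add: Const_def Cpol.c_add Cpol.c_mult Cpol.c_one)

lemma eval_Cpol_Xpol:
  fixes p :: "'a :: field mpol"
  shows "mpol_eval Cpol Xpol p = p"
proof -
  have *: "(\<Prod>i\<in>Poly_Mapping.keys m. Xpol i ^ Poly_Mapping.lookup m i) = Poly_Mapping.single m (1 :: 'a)"
    for m
  proof -
    have pow: "Xpol i ^ k = Poly_Mapping.single (Poly_Mapping.single i k) (1 :: 'a)" for i k
      by (induction k) (simp_all add: Xpol_def mult_single flip: Poly_Mapping.single_add)
    have "(\<Prod>i\<in>A. Poly_Mapping.single (f i) (1 :: 'a)) = Poly_Mapping.single (sum f A) 1"
      if "finite A" for A and f :: "nat \<Rightarrow> nat \<Rightarrow>\<^sub>0 nat"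
      using that by induction (simp_all add: mult_single)
    moreover have "(\<Sum>i\<in>Poly_Mapping.keys m. Poly_Mapping.single i (Poly_Mapping.lookup m i)) = m"
      by (rule poly_mapping_eqI)
         (simp add: lookup_sum lookup_single when_def in_keys_iff)
    ultimately show ?thesis by (simp add: pow)
  qed
  show ?thesis
    using Cpol.mpol_sum_single[of p] by (simp add: mpol_eval_def * Cpol_def mult_single)
qed

lemma eval_Const_to_fract:
  "mpol_eval Const (\<lambda>i. to_fract (g i)) p = to_fract (mpol_eval Cpol g p)"
proof -
  have s: "to_fract (sum f A) = (\<Sum>x\<in>A. to_fract (f x))" for f :: "'z \<Rightarrow> 'a mpol" and A
    by (induction A rule: infinite_finite_induct) simp_all
  have e: "to_fract (x ^ k) = to_fract x ^ k" for x :: "'a mpol" and k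
    by (induction k) simp_all
  have p: "to_fract (prod f A) = (\<Prod>x\<in>A. to_fract (f x))" for f :: "'z \<Rightarrow> 'a mpol" and A
    by (induction A rule: infinite_finite_induct) simp_all
  show ?thesis
    by (simp add: mpol_eval_def s e p Const_def)
qed

definition var_image_pol :: "'a :: field mat \<Rightarrow> nat \<Rightarrow> 'a mpol" where
  "var_image_pol T j =
     (if j < dim_col T then (\<Sum>i<dim_row T. Cpol (T $$ (i, j)) * Xpol i) else Xpol j)"

lemma var_image_pol: "var_image T j = to_fract (var_image_pol T j)"
proof -
  have s: "to_fract (sum f A) = (\<Sum>x\<in>A. to_fract (f x))" for f :: "nat \<Rightarrow> 'a mpol" and A
    by (induction A rule: infinite_finite_induct) simp_all
  show ?thesis
    by (auto simp: var_image_def var_image_pol_def scalar_prod_def Xvar_def Const_def s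
          lessThan_atLeast0 mult.commute intro!: sum.cong)
qed

lemma var_image_pol_inverse:
  assumes "T \<in> carrier_mat n n" "B \<in> carrier_mat n n" "B * T = 1\<^sub>m n"
  shows "mpol_eval Cpol (var_image_pol B) (var_image_pol T j) = Xpol j"
proof (cases "j < n")
  case False
  then show ?thesis using assms by (simp add: var_image_pol_def Cpol.eval_Xpol)
next
  case True
  have BT: "(\<Sum>i<n. B $$ (l, i) * T $$ (i, j)) = (if l = j then 1 else 0)" if "l < n" for l
  proof -
    have "(B * T) $$ (l, j) = (\<Sum>i<n. B $$ (l, i) * T $$ (i, j))"
      using assms(1,2) True that by (simp add: scalar_prod_def lessThan_atLeast0)
    moreover have "(B * T) $$ (l, j) = (if l = j then 1 else 0)"
      unfolding assms(3) using True that by simp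
    ultimately show ?thesis by metis
  qed
  have Csum: "Cpol (sum f A) = (\<Sum>x\<in>A. Cpol (f x))" for f :: "nat \<Rightarrow> 'a" and A
    by (induction A rule: infinite_finite_induct) (simp_all add: Cpol.c_zero Cpol.c_add)
  have "mpol_eval Cpol (var_image_pol B) (var_image_pol T j) =
      (\<Sum>i<n. Cpol (T $$ (i, j)) * (\<Sum>l<n. Cpol (B $$ (l, i)) * Xpol l))"
    using assms True
    by (simp add: var_image_pol_def Cpol.eval_sum Cpol.eval_mult Cpol.eval_Cpol Cpol.eval_Xpol)
  also have "\<dots> = (\<Sum>l<n. \<Sum>i<n. Cpol (B $$ (l, i) * T $$ (i, j)) * Xpol l)"
    unfolding sum_distrib_left by (subst sum.swap) (simp add: Cpol.c_mult mult_ac)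
  also have "\<dots> = (\<Sum>l<n. Cpol (\<Sum>i<n. B $$ (l, i) * T $$ (i, j)) * Xpol l)"
    by (simp add: Csum sum_distrib_right)
  also have "\<dots> = (\<Sum>l<n. if l = j then Xpol l else 0)"
    by (rule sum.cong) (simp_all add: BT Cpol.c_zero Cpol.c_one)
  also have "\<dots> = Xpol j" using True by simp
  finally show ?thesis .
qed

lemma eval_var_image_eq_0_iff:
  assumes "T \<in> GL n"
  shows "mpol_eval Const (var_image T) p = 0 \<longleftrightarrow> p = 0"
proof
  assume 0: "mpol_eval Const (var_image T) p = 0"
  obtain B where T: "T \<in> carrier_mat n n" and TB: "T * B = 1\<^sub>m n" and BT: "B * T = 1\<^sub>m (dim_row B)"
    using assms by (auto simp: GL_def invertible_mat_def inverts_mat_def)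
  have "dim_col B = n" using arg_cong[OF TB, of dim_col] by simp
  moreover have "dim_row B = n" using arg_cong[OF BT, of dim_col] T by simp
  ultimately have B: "B \<in> carrier_mat n n" and BT': "B * T = 1\<^sub>m n" using BT by auto
  have "mpol_eval Cpol (var_image_pol T) p = 0"
    using 0 by (simp add: var_image_pol[abs_def] eval_Const_to_fract)
  then have "mpol_eval Cpol (var_image_pol B) (mpol_eval Cpol (var_image_pol T) p) = 0"
    by (simp add: Cpol.eval_zero)
  then show "p = 0"
    by (simp add: Cpol.eval_eval var_image_pol_inverse[OF T B BT'] eval_Cpol_Xpol)
qed (simp add: Const.eval_zero)

lemma sigma_Fract:
  assumes "T \<in> GL n" "b \<noteq> 0"
  shows "sigma T (Fraction_Field.Fract a b) =
    mpol_eval Const (var_image T) a / mpol_eval Const (var_image T) b"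
  unfolding sigma_def
proof (rule the_equality)
  fix y
  assume "\<exists>a' b'. b' \<noteq> 0 \<and> Fraction_Field.Fract a b = Fraction_Field.Fract a' b' \<and>
    y = mpol_eval Const (var_image T) a' / mpol_eval Const (var_image T) b'"
  then obtain a' b' where b': "b' \<noteq> 0" and eq: "Fraction_Field.Fract a b = Fraction_Field.Fract a' b'"
    and y: "y = mpol_eval Const (var_image T) a' / mpol_eval Const (var_image T) b'"
    by blast
  have "a * b' = a' * b" using eq assms b' by (simp add: eq_fract)
  then have "mpol_eval Const (var_image T) a * mpol_eval Const (var_image T) b' =
      mpol_eval Const (var_image T) a' * mpol_eval Const (var_image T) b"
    by (metis Const.eval_mult)
  then show "y = mpol_eval Const (var_image T) a / mpol_eval Const (var_image T) b"
    using eval_var_image_eq_0_iff[OF assms(1)] assms(2) b' y by (simp add: frac_eq_eq)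
qed (use assms in blast)

lemma sigma_Xvar: "T \<in> GL n \<Longrightarrow> sigma T (Xvar j) = var_image T j"
  by (simp add: Xvar_def to_fract_def sigma_Fract Const.eval_Xpol Const.eval_one)

lemma sigma_Const: "T \<in> GL n \<Longrightarrow> sigma T (Const c) = Const c"
  by (simp add: Const_def[of c] to_fract_def sigma_Fract Const.eval_Cpol Const.eval_one)

lemma sigma_add:
  assumes "T \<in> GL n"
  shows "sigma T (f + g) = sigma T f + sigma T g"
  using assms eval_var_image_eq_0_iff[OF assms]
  by (cases f; cases g)
     (simp add: sigma_Fract Const.eval_add Const.eval_mult add_frac_eq)

lemma sigma_mult:
  assumes "T \<in> GL n"
  shows "sigma T (f * g) = sigma T f * sigma T g"
  using assms by (cases f; cases g) (simp add: sigma_Fract Const.eval_mult)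

end

theory Submission
  imports Defs "Jordan_Normal_Form.Determinant"
begin

text \<open>
  Put \<open>N = 2 * \<nu>\<close>, let \<open>q\<close> be the size of the ground field \<open>F\<close>, let \<open>X = (X\<^sub>1, \<dots>, X\<^sub>N)\<close>, and let \<open>K\<close> be the field
  generated by the proposed generators. In characteristic two a matrix that preserves \<open>S\<close> fixes the last
  variable and preserves \<open>\<Sum>i. X\<^sub>i * X (flip i) ^ q ^ k\<close> over all \<open>n\<close> indices, hence also the generators
  (\<open>Ps_fixes_generators\<close>).

  For the converse, invertibility of the Moore matrix with rows \<open>X\<^bsup>[i]\<^esup> = (X\<^sub>j ^ q ^ i)\<^sub>j\<close> is the main tool. It
  follows by counting roots, as there are \<open>q ^ N\<close> linear forms (\<open>moore_rows_independent\<close>).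

  \<^item> The values of the alternating form \<open>B\<close> on pairs \<open>X\<^bsup>[i]\<^esup>, X\<^bsup>[j]\<^esup>\<close> with \<open>i, j \<le> N\<close> are \<open>0\<close> or Frobenius powers
    of generators. Hence the coefficients of the relation \<open>X\<^bsup>[N]\<^esup> = \<Sum>i<N. c i * X\<^bsup>[i]\<^esup>\<close> solve a nonsingular linear
    system over \<open>K\<close> and lie in \<open>K\<close> (\<open>frobenius_relation_coefficients\<close>). So all elements of the space \<open>V\<close> of
    linear forms satisfy one monic equation over \<open>K\<close> whose degree is the size of \<open>V\<close>.

  \<^item> A vector in \<open>V ^ N\<close> is \<open>X T\<close> with a matrix \<open>T\<close> over \<open>F\<close>. If the generators take the same values there as at
    \<open>X\<close>, then \<open>X (T J T\<^sup>t - J)\<close> is orthogonal to \<open>X\<^bsup>[1]\<^esup>, \<dots>, X\<^bsup>[N]\<^esup>\<close> and so is \<open>0\<close>. Since the \<open>X\<^sub>i\<close> are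
    independent over \<open>F\<close>, this means that \<open>T\<close> is symplectic (\<open>symplectic_from_pairing\<close>).

  In other words, the conjugates of \<open>X\<close> over \<open>K\<close> are its images under the group, and Galois theory gives the
  result. In place of Galois theory a direct argument is used. Choose a \<open>K\<close>-linear retraction \<open>\<phi>\<close> onto \<open>K\<close>.
  By interpolation on the grid \<open>V ^ N\<close>, the functional \<open>f \<mapsto> \<phi> (f X)\<close> on polynomials over \<open>K\<close> is a weighted sum
  of point evaluations, and only the points that satisfy the same relations as \<open>X\<close> get a nonzero weight. If
  \<open>f\<close> is an invariant polynomial, it has the value \<open>f X\<close> at each of these points, so \<open>\<phi> (f X) = f X\<close> and \<open>f X\<close> lies
  in \<open>K\<close> (\<open>polyfun_value_in_subfield\<close>). Invariant fractions reduce to invariant polynomials by completing the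
  denominator to the product of its orbit (\<open>invariants_from_polynomial_invariants\<close>).
\<close>

section \<open>Linear retractions onto a subfield\<close>

locale subfield_set =
  fixes K :: "'b :: field set"
  assumes one_mem: "1 \<in> K"
    and diff_mem: "x \<in> K \<Longrightarrow> y \<in> K \<Longrightarrow> x - y \<in> K"
    and mult_mem: "x \<in> K \<Longrightarrow> y \<in> K \<Longrightarrow> x * y \<in> K"
    and inverse_mem: "x \<in> K \<Longrightarrow> inverse x \<in> K"
begin

lemma zero_mem: "0 \<in> K"
  using diff_mem[OF one_mem one_mem] by simp

lemma minus_mem: "x \<in> K \<Longrightarrow> - x \<in> K"
  using diff_mem[OF zero_mem, of x] by simp

lemma add_mem: "x \<in> K \<Longrightarrow> y \<in> K \<Longrightarrow> x + y \<in> K"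
  using diff_mem[of x "- y"] minus_mem[of y] by simp

lemma divide_mem: "x \<in> K \<Longrightarrow> y \<in> K \<Longrightarrow> x / y \<in> K"
  using mult_mem[OF _ inverse_mem, of x y] by (simp add: field_simps)

lemma sum_mem: "(\<And>i. i \<in> A \<Longrightarrow> f i \<in> K) \<Longrightarrow> sum f A \<in> K"
  by (induction A rule: infinite_finite_induct) (auto simp: zero_mem add_mem)

lemma prod_mem: "(\<And>i. i \<in> A \<Longrightarrow> f i \<in> K) \<Longrightarrow> prod f A \<in> K"
  by (induction A rule: infinite_finite_induct) (auto simp: one_mem mult_mem)

lemma power_mem: "x \<in> K \<Longrightarrow> x ^ k \<in> K"
  by (induction k) (auto simp: one_mem mult_mem)

text \<open>
  The kernel of such a retraction is a \<open>K\<close>-subspace that is maximal among those without \<open>1\<close>.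
  Maximality makes it a complement of \<open>K\<close>. The retraction stands in for Galois descent below: a
  solution of a linear system over \<open>K\<close> is moved to another solution, so a unique one lies in \<open>K\<close>.
\<close>

lemma exists_linear_retraction:
  obtains \<phi> where "\<And>x. \<phi> x \<in> K" "\<And>x y. \<phi> (x + y) = \<phi> x + \<phi> y"
    "\<And>c x. c \<in> K \<Longrightarrow> \<phi> (c * x) = c * \<phi> x" "\<phi> 1 = 1"
proof -
  define \<U> where "\<U> = {U. 0 \<in> U \<and> (\<forall>x\<in>U. \<forall>y\<in>U. x + y \<in> U) \<and> (\<forall>c\<in>K. \<forall>x\<in>U. c * x \<in> U) \<and> 1 \<notin> U}"
  have "{0} \<in> \<U>" by (simp add: \<U>_def)
  moreover have "\<Union>\<C> \<in> \<U>" if "\<C> \<noteq> {}" "subset.chain \<U> \<C>" for \<C>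
  proof -
    have sub: "\<C> \<subseteq> \<U>" and chain: "\<And>A B. A \<in> \<C> \<Longrightarrow> B \<in> \<C> \<Longrightarrow> A \<subseteq> B \<or> B \<subseteq> A"
      using that(2) by (auto simp: subset_chain_def)
    have "x + y \<in> \<Union>\<C>" if xy: "x \<in> \<Union>\<C>" "y \<in> \<Union>\<C>" for x y
    proof -
      obtain A B where "A \<in> \<C>" "x \<in> A" "B \<in> \<C>" "y \<in> B" using xy by (meson UnionE)
      then obtain C where "C \<in> \<C>" "x \<in> C" "y \<in> C" using chain[of A B] by blast
      moreover have "x + y \<in> C" using calculation sub by (auto simp: \<U>_def)
      ultimately show ?thesis by blast
    qed
    moreover have "0 \<in> \<Union>\<C>" using that(1) sub by (auto simp: \<U>_def)
    moreover have "c * x \<in> \<Union>\<C>" if "c \<in> K" "x \<in> \<Union>\<C>" for c x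
      using that sub by (auto simp: \<U>_def)
    moreover have "1 \<notin> \<Union>\<C>" using sub by (auto simp: \<U>_def)
    ultimately show ?thesis by (simp add: \<U>_def)
  qed
  ultimately obtain U where U: "U \<in> \<U>" and max: "\<And>W. W \<in> \<U> \<Longrightarrow> U \<subseteq> W \<Longrightarrow> W = U"
    using subset_Zorn_nonempty[of \<U>] by blast
  have U0: "0 \<in> U" and Uadd: "\<And>x y. x \<in> U \<Longrightarrow> y \<in> U \<Longrightarrow> x + y \<in> U"
    and Uscale: "\<And>c x. c \<in> K \<Longrightarrow> x \<in> U \<Longrightarrow> c * x \<in> U" and U1: "1 \<notin> U"
    using U by (auto simp: \<U>_def)
  have Udiff: "x - y \<in> U" if "x \<in> U" "y \<in> U" for x y
    using Uadd[OF that(1) Uscale[OF minus_mem[OF one_mem] that(2)]] by simp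
  have ex: "\<exists>c\<in>K. x - c \<in> U" for x
  proof (cases "x \<in> U")
    case True
    then show ?thesis using zero_mem by (intro bexI[of _ 0]) auto
  next
    case False
    define W where "W = {u + k * x | u k. u \<in> U \<and> k \<in> K}"
    have WI: "u + k * x \<in> W" if "u \<in> U" "k \<in> K" for u k
      using that by (auto simp: W_def)
    have "U \<subseteq> W" using WI[OF _ zero_mem] by auto
    moreover have "x \<in> W" using WI[OF U0 one_mem] by simp
    ultimately have "W \<notin> \<U>" using max[of W] False by blast
    moreover have "0 \<in> W" using \<open>U \<subseteq> W\<close> U0 by auto
    moreover have "y + z \<in> W" if yz: "y \<in> W" "z \<in> W" for y z
    proof -
      obtain u k u' k' where eq: "y = u + k * x" "z = u' + k' * x"
        and m: "u \<in> U" "k \<in> K" "u' \<in> U" "k' \<in> K" using yz by (auto simp: W_def)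
      have "(u + u') + (k + k') * x \<in> W" using m by (intro WI Uadd add_mem)
      then show ?thesis by (simp add: eq algebra_simps)
    qed
    moreover have "c * y \<in> W" if c: "c \<in> K" "y \<in> W" for c y
    proof -
      obtain u k where eq: "y = u + k * x" and m: "u \<in> U" "k \<in> K" using c by (auto simp: W_def)
      have "c * u + (c * k) * x \<in> W" using m c by (intro WI Uscale mult_mem)
      then show ?thesis by (simp add: eq algebra_simps)
    qed
    ultimately have "1 \<in> W" by (auto simp: \<U>_def)
    then obtain u k where eq: "1 = u + k * x" and uk: "u \<in> U" "k \<in> K" by (auto simp: W_def)
    have "k \<noteq> 0" using eq uk U1 by auto
    then have "x - inverse k = (- inverse k) * u"
    proof -
      have "inverse k = inverse k * (u + k * x)" using eq by simp
      also have "\<dots> = inverse k * u + x" using \<open>k \<noteq> 0\<close> by (simp add: distrib_left flip: mult.assoc)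
      finally show ?thesis by (simp add: algebra_simps)
    qed
    moreover have "(- inverse k) * u \<in> U" using uk by (intro Uscale minus_mem inverse_mem)
    ultimately show ?thesis using uk by (metis inverse_mem)
  qed
  have unique: "c = c'" if "c \<in> K" "c' \<in> K" "x - c \<in> U" "x - c' \<in> U" for x c c'
  proof (rule ccontr)
    assume "c \<noteq> c'"
    have "c - c' \<in> U" using Udiff[OF that(4,3)] by simp
    then have "inverse (c - c') * (c - c') \<in> U"
      using that by (intro Uscale inverse_mem diff_mem)
    then show False using U1 \<open>c \<noteq> c'\<close> by simp
  qed
  define \<phi> where "\<phi> x = (SOME c. c \<in> K \<and> x - c \<in> U)" for x
  have \<phi>: "\<phi> x \<in> K \<and> x - \<phi> x \<in> U" for x
    unfolding \<phi>_def by (rule someI_ex) (use ex in blast)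
  have eqI: "\<phi> x = c" if "c \<in> K" "x - c \<in> U" for x c
    using unique \<phi> that by blast
  show thesis
  proof
    show "\<phi> x \<in> K" for x using \<phi> by blast
    show "\<phi> (x + y) = \<phi> x + \<phi> y" for x y
      using \<phi>[of x] \<phi>[of y] Uadd[of "x - \<phi> x" "y - \<phi> y"]
      by (intro eqI add_mem) (simp_all add: algebra_simps)
    show "\<phi> (c * x) = c * \<phi> x" if "c \<in> K" for c x
      using \<phi>[of x] Uscale[OF that, of "x - \<phi> x"] that
      by (intro eqI mult_mem) (simp_all add: algebra_simps)
    show "\<phi> 1 = 1" by (rule eqI) (simp_all add: one_mem U0)
  qed
qed

end

section \<open>Polynomial functions on a finite grid\<close>

text \<open>
  \<open>\<eta> a v\<close> is the coefficient at \<open>t ^ a\<close> of the Lagrange polynomial that is \<open>1\<close> at \<open>v\<close> and \<open>0\<close> elsewhere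
  on \<open>V\<close>. Both equations say that the square matrices \<open>(\<eta> a v)\<close> and \<open>(v ^ a)\<close> are inverse to each
  other.
\<close>

lemma lagrange_coefficients:
  fixes V :: "'b :: field set"
  assumes "finite V"
  obtains \<eta> :: "nat \<Rightarrow> 'b \<Rightarrow> 'b"
  where "\<And>t v. t \<in> V \<Longrightarrow> v \<in> V \<Longrightarrow> (\<Sum>a<card V. \<eta> a v * t ^ a) = (if t = v then 1 else 0)"
    and "\<And>a b. a < card V \<Longrightarrow> b < card V \<Longrightarrow> (\<Sum>v\<in>V. \<eta> a v * v ^ b) = (if a = b then 1 else 0)"
proof -
  define L where "L v = (\<Prod>u\<in>V-{v}. smult (inverse (v - u)) [:-u, 1:])" for v
  have poly_L: "poly (L v) t = (if t = v then 1 else 0)" if "t \<in> V" "v \<in> V" for t v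
  proof (cases "t = v")
    case True
    have "(\<Prod>u\<in>V-{v}. poly (smult (inverse (v - u)) [:-u, 1:]) v) = 1"
    proof (rule prod.neutral, intro ballI)
      fix u assume "u \<in> V - {v}"
      then have "inverse (v - u) * (v - u) = 1" by (intro left_inverse) auto
      then show "poly (smult (inverse (v - u)) [:-u, 1:]) v = 1" by (simp add: algebra_simps)
    qed
    then show ?thesis using True unfolding L_def poly_prod by simp
  next
    case False
    then show ?thesis using that assms by (auto simp: L_def poly_prod prod_zero_iff)
  qed
  have deg_L: "degree (L v) < card V" if "v \<in> V" for v
  proof -
    have "degree (L v) \<le> (\<Sum>u\<in>V-{v}. degree (smult (inverse (v - u)) [:-u, 1:]))"
      unfolding L_def by (rule degree_prod_sum_le[unfolded o_def]) (use assms in simp)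
    also have "\<dots> \<le> (\<Sum>u\<in>V-{v}. 1)"
      by (rule sum_mono) simp
    also have "\<dots> < card V"
      using card_Diff1_less[OF assms that] by simp
    finally show ?thesis .
  qed
  show thesis
  proof
    fix t v assume tv: "t \<in> V" "v \<in> V"
    have "poly (L v) t = (\<Sum>a\<le>degree (L v). coeff (L v) a * t ^ a)" by (rule poly_altdef)
    also have "\<dots> = (\<Sum>a<card V. coeff (L v) a * t ^ a)"
      by (rule sum.mono_neutral_left) (use deg_L[OF tv(2)] in \<open>auto simp: coeff_eq_0\<close>)
    finally show "(\<Sum>a<card V. coeff (L v) a * t ^ a) = (if t = v then 1 else 0)"
      using poly_L[OF tv] by simp
  next
    fix a b assume ab: "a < card V" "b < card V"
    have "(\<Sum>v\<in>V. smult (v ^ b) (L v)) = monom 1 b"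
    proof (rule poly_eqI_degree)
      fix t assume t: "t \<in> V"
      have "poly (\<Sum>v\<in>V. smult (v ^ b) (L v)) t = (\<Sum>v\<in>V. if t = v then v ^ b else 0)"
        by (simp add: poly_sum) (rule sum.cong, use poly_L[OF t] in auto)
      also have "\<dots> = t ^ b" using t assms by simp
      finally show "poly (\<Sum>v\<in>V. smult (v ^ b) (L v)) t = poly (monom 1 b) t"
        by (simp add: poly_monom)
    next
      have "degree (\<Sum>v\<in>V. smult (v ^ b) (L v)) \<le> card V - 1"
      proof (rule degree_sum_le[OF assms])
        fix v assume "v \<in> V"
        then have "degree (L v) \<le> card V - 1" using deg_L[of v] by linarith
        then show "degree (smult (v ^ b) (L v)) \<le> card V - 1"
          using degree_smult_le order.trans by blast
      qed
      then show "degree (\<Sum>v\<in>V. smult (v ^ b) (L v)) < card V" using ab by linarith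
      show "degree (monom 1 b :: 'b poly) < card V" using ab by (simp add: degree_monom_eq)
    qed
    from arg_cong[OF this, of "\<lambda>p. coeff p a"]
    show "(\<Sum>v\<in>V. coeff (L v) a * v ^ b) = (if a = b then 1 else 0)"
      by (simp add: coeff_sum mult.commute eq_commute)
  qed
qed

inductive_set polyfuns :: "'b :: field set \<Rightarrow> 'i set \<Rightarrow> (('i \<Rightarrow> 'b) \<Rightarrow> 'b) set" for K I where
  polyfuns_const: "c \<in> K \<Longrightarrow> (\<lambda>_. c) \<in> polyfuns K I"
| polyfuns_coord: "i \<in> I \<Longrightarrow> (\<lambda>x. x i) \<in> polyfuns K I"
| polyfuns_add: "f \<in> polyfuns K I \<Longrightarrow> g \<in> polyfuns K I \<Longrightarrow> (\<lambda>x. f x + g x) \<in> polyfuns K I"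
| polyfuns_mult: "f \<in> polyfuns K I \<Longrightarrow> g \<in> polyfuns K I \<Longrightarrow> (\<lambda>x. f x * g x) \<in> polyfuns K I"

lemma polyfuns_cong:
  "f \<in> polyfuns K I \<Longrightarrow> (\<And>i. i \<in> I \<Longrightarrow> x i = y i) \<Longrightarrow> f x = f y"
  by (induction rule: polyfuns.induct) auto

context subfield_set
begin

lemma polyfuns_sum:
  "(\<And>a. a \<in> A \<Longrightarrow> f a \<in> polyfuns K I) \<Longrightarrow> (\<lambda>x. \<Sum>a\<in>A. f a x) \<in> polyfuns K I"
  by (induction A rule: infinite_finite_induct)
     (auto intro: polyfuns_const polyfuns_add zero_mem)

lemma polyfuns_prod:
  "(\<And>a. a \<in> A \<Longrightarrow> f a \<in> polyfuns K I) \<Longrightarrow> (\<lambda>x. \<Prod>a\<in>A. f a x) \<in> polyfuns K I"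
  by (induction A rule: infinite_finite_induct)
     (auto intro: polyfuns_const polyfuns_mult one_mem)

lemma polyfuns_power: "f \<in> polyfuns K I \<Longrightarrow> (\<lambda>x. f x ^ k) \<in> polyfuns K I"
  by (induction k) (auto intro: polyfuns_const polyfuns_mult one_mem)

text \<open>
  A monic relation of degree \<open>Q\<close> over \<open>K\<close> that holds on all of \<open>V\<close> reduces every power to exponents below
  \<open>Q\<close>, with coefficients that stay in \<open>K\<close> and are the same for all points of \<open>V\<close>.
\<close>

lemma power_reduction:
  assumes d: "\<And>i. d i \<in> K" and red: "\<And>v. v \<in> V \<Longrightarrow> v ^ Q = (\<Sum>i<Q. d i * v ^ i)" and "Q > 0"
  shows "\<exists>\<rho>. (\<forall>i. \<rho> i \<in> K) \<and> (\<forall>v\<in>V. v ^ m = (\<Sum>i<Q. \<rho> i * v ^ i))"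
proof (induction m)
  case 0
  have "(\<Sum>i<Q. (if i = 0 then 1 else 0) * v ^ i) = 1" for v :: 'b
    using \<open>Q > 0\<close> by (subst sum.mono_neutral_right[of _ "{0}"]) auto
  then show ?case
    by (intro exI[of _ "\<lambda>i. if i = 0 then 1 else 0"]) (auto simp: zero_mem one_mem)
next
  case (Suc m)
  then obtain \<rho> where \<rho>: "\<And>i. \<rho> i \<in> K" and eq: "\<And>v. v \<in> V \<Longrightarrow> v ^ m = (\<Sum>i<Q. \<rho> i * v ^ i)"
    by blast
  obtain P where P: "Q = Suc P" using \<open>Q > 0\<close> gr0_implies_Suc by blast
  define \<rho>' where "\<rho>' i = (if i = 0 then 0 else \<rho> (i - 1)) + \<rho> P * d i" for i
  have "v ^ Suc m = (\<Sum>i<Q. \<rho>' i * v ^ i)" if "v \<in> V" for v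
  proof -
    have "v ^ Suc m = (\<Sum>i<P. \<rho> i * v ^ Suc i) + \<rho> P * v ^ Q"
      using eq[OF that] by (simp add: P sum_distrib_left algebra_simps)
    also have "(\<Sum>i<P. \<rho> i * v ^ Suc i) = (\<Sum>i<Q. (if i = 0 then 0 else \<rho> (i - 1)) * v ^ i)"
      unfolding P by (subst sum.lessThan_Suc_shift) simp
    finally show ?thesis
      by (simp add: red[OF that] \<rho>'_def sum_distrib_left sum.distrib algebra_simps)
  qed
  moreover have "\<rho>' i \<in> K" for i
    unfolding \<rho>'_def using \<rho> d by (auto intro!: add_mem mult_mem zero_mem)
  ultimately show ?case by blast
qed

text \<open>
  On the grid \<open>V ^ I\<close>, every polynomial function over \<open>K\<close> is a \<open>K\<close>-combination of the monomials whose
  exponents are all smaller than \<open>card V\<close>. By Lagrange interpolation these monomials form a basis, over the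
  large field, of all functions on the grid.
\<close>

lemma polyfuns_normal_form:
  fixes I :: "'i set" and V :: "'b set"
  assumes I: "finite I" and V: "finite V" "V \<noteq> {}" and d: "\<And>i. d i \<in> K"
    and red: "\<And>v. v \<in> V \<Longrightarrow> v ^ card V = (\<Sum>i<card V. d i * v ^ i)"
    and f: "f \<in> polyfuns K I"
  shows "\<exists>\<rho>. (\<forall>a. \<rho> a \<in> K) \<and> (\<forall>z\<in>PiE I (\<lambda>_. V).
    f z = (\<Sum>a\<in>PiE I (\<lambda>_. {..<card V}). \<rho> a * (\<Prod>i\<in>I. z i ^ a i)))"
proof -
  define Q where "Q = card V"
  have Q: "Q > 0" using V by (simp add: Q_def card_gt_0_iff)
  define A where "A = PiE I (\<lambda>_. {..<Q})"
  have A: "finite A" using I by (simp add: A_def finite_PiE)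
  define nf where "nf f \<longleftrightarrow> (\<exists>\<rho>. (\<forall>a. \<rho> a \<in> K) \<and>
    (\<forall>z\<in>PiE I (\<lambda>_. V). f z = (\<Sum>a\<in>A. \<rho> a * (\<Prod>i\<in>I. z i ^ a i))))" for f
  have nfI: "nf f" if "\<And>a. \<rho> a \<in> K"
    "\<And>z. z \<in> PiE I (\<lambda>_. V) \<Longrightarrow> f z = (\<Sum>a\<in>A. \<rho> a * (\<Prod>i\<in>I. z i ^ a i))" for f \<rho>
    using that by (auto simp: nf_def)
  have nf_cong: "nf f" if "nf g" "\<And>z. z \<in> PiE I (\<lambda>_. V) \<Longrightarrow> f z = g z" for f g
    using that by (auto simp: nf_def)
  have add: "nf (\<lambda>z. f z + g z)" if fg: "nf f" "nf g" for f g
  proof -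
    obtain \<rho> where \<rho>: "\<And>a. \<rho> a \<in> K"
      "\<And>z. z \<in> PiE I (\<lambda>_. V) \<Longrightarrow> f z = (\<Sum>a\<in>A. \<rho> a * (\<Prod>i\<in>I. z i ^ a i))"
      using fg(1) unfolding nf_def by blast
    obtain \<sigma> where \<sigma>: "\<And>a. \<sigma> a \<in> K"
      "\<And>z. z \<in> PiE I (\<lambda>_. V) \<Longrightarrow> g z = (\<Sum>a\<in>A. \<sigma> a * (\<Prod>i\<in>I. z i ^ a i))"
      using fg(2) unfolding nf_def by blast
    from \<rho> \<sigma> show ?thesis
      by (intro nfI[of "\<lambda>a. \<rho> a + \<sigma> a"]) (auto simp: add_mem sum.distrib algebra_simps)
  qed
  have scale: "nf (\<lambda>z. c * f z)" if fc: "nf f" "c \<in> K" for c f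
  proof -
    obtain \<rho> where "\<And>a. \<rho> a \<in> K"
      "\<And>z. z \<in> PiE I (\<lambda>_. V) \<Longrightarrow> f z = (\<Sum>a\<in>A. \<rho> a * (\<Prod>i\<in>I. z i ^ a i))"
      using fc by (auto simp: nf_def)
    then show ?thesis using fc
      by (intro nfI[of "\<lambda>a. c * \<rho> a"]) (auto simp: mult_mem sum_distrib_left algebra_simps)
  qed
  have zero: "nf (\<lambda>z. 0)" by (rule nfI[of "\<lambda>_. 0"]) (auto simp: zero_mem)
  have sum: "nf (\<lambda>z. \<Sum>a\<in>B. f a z)" if "\<And>a. a \<in> B \<Longrightarrow> nf (f a)" for B :: "'s set" and f
    using that by (induction B rule: infinite_finite_induct) (auto simp: zero intro: add)
  have mono: "nf (\<lambda>z. \<Prod>i\<in>I. z i ^ m i)" for m :: "'i \<Rightarrow> nat"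
  proof -
    have "\<forall>k. \<exists>\<rho>. (\<forall>i. \<rho> i \<in> K) \<and> (\<forall>v\<in>V. v ^ k = (\<Sum>i<Q. \<rho> i * v ^ i))"
      using power_reduction[of d V Q, OF d] red Q unfolding Q_def by blast
    then obtain \<rho> where \<rho>: "\<And>k i. \<rho> k i \<in> K"
      and eq: "\<And>k v. v \<in> V \<Longrightarrow> v ^ k = (\<Sum>i<Q. \<rho> k i * v ^ i)"
      by metis
    show ?thesis
    proof (rule nfI[of "\<lambda>a. \<Prod>i\<in>I. \<rho> (m i) (a i)"])
      show "(\<Prod>i\<in>I. \<rho> (m i) (a i)) \<in> K" for a by (rule prod_mem) (rule \<rho>)
      fix z assume z: "z \<in> PiE I (\<lambda>_. V)"
      have "(\<Prod>i\<in>I. z i ^ m i) = (\<Prod>i\<in>I. \<Sum>b<Q. \<rho> (m i) b * z i ^ b)"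
        by (rule prod.cong[OF refl], rule eq) (use z in auto)
      also have "\<dots> = (\<Sum>a\<in>A. \<Prod>i\<in>I. \<rho> (m i) (a i) * z i ^ a i)"
        unfolding A_def by (rule prod_sum_PiE) (use I in auto)
      finally show "(\<Prod>i\<in>I. z i ^ m i) = (\<Sum>a\<in>A. (\<Prod>i\<in>I. \<rho> (m i) (a i)) * (\<Prod>i\<in>I. z i ^ a i))"
        by (simp add: prod.distrib)
    qed
  qed
  have "nf f" using f
  proof induction
    case (polyfuns_const c)
    show ?case using scale[OF mono polyfuns_const, of "\<lambda>_. 0"] by simp
  next
    case (polyfuns_coord j)
    have "(\<Prod>i\<in>I. z i ^ (if i = j then 1 else 0)) = z j" for z :: "'i \<Rightarrow> 'b"
      using polyfuns_coord I by (subst prod.mono_neutral_right[of _ "{j}"]) auto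
    then show ?case using mono[of "\<lambda>i. if i = j then 1 else 0"] by simp
  next
    case (polyfuns_add f g)
    then show ?case by (intro add)
  next
    case (polyfuns_mult f g)
    obtain \<rho> where \<rho>: "\<And>a. \<rho> a \<in> K"
      "\<And>z. z \<in> PiE I (\<lambda>_. V) \<Longrightarrow> f z = (\<Sum>a\<in>A. \<rho> a * (\<Prod>i\<in>I. z i ^ a i))"
      using polyfuns_mult.IH(1) unfolding nf_def by blast
    obtain \<sigma> where \<sigma>: "\<And>a. \<sigma> a \<in> K"
      "\<And>z. z \<in> PiE I (\<lambda>_. V) \<Longrightarrow> g z = (\<Sum>a\<in>A. \<sigma> a * (\<Prod>i\<in>I. z i ^ a i))"
      using polyfuns_mult.IH(2) unfolding nf_def by blast
    have "nf (\<lambda>z. \<Sum>a\<in>A. \<Sum>b\<in>A. (\<rho> a * \<sigma> b) * (\<Prod>i\<in>I. z i ^ (a i + b i)))"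
      by (intro sum scale mono mult_mem \<rho> \<sigma>)
    then show ?case
      by (rule nf_cong)
         (simp add: \<rho> \<sigma> sum_product power_add prod.distrib algebra_simps)
  qed
  then show ?thesis by (simp add: nf_def A_def Q_def)
qed

text \<open>
  A substitute for the fundamental theorem of Galois theory. Think of \<open>\<xi>\<close> as a point whose conjugates over
  \<open>K\<close> lie in the grid \<open>V ^ I\<close> and are cut out there by the relations \<open>R\<close>. If \<open>g\<close>, a polynomial function over
  \<open>K\<close>, takes the same value at all conjugates, then this value is in \<open>K\<close>.
  
  Let \<open>\<phi>\<close> be a \<open>K\<close>-linear retraction onto \<open>K\<close>. The functional \<open>f \<mapsto> \<phi> (f \<xi>)\<close> on polynomial functions over \<open>K\<close>
  is determined by its values on reduced monomials, so Lagrange interpolation writes it as a weighted sum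
  \<open>\<Sum>z. w z * f z\<close> over the grid. It kills all multiples of each \<open>r \<in> R\<close>, and polynomial functions span
  all functions on the grid, hence \<open>w * r = 0\<close> and \<open>w\<close> lives on the common zeros of \<open>R\<close>. There \<open>g\<close> is
  constant, so \<open>\<phi> (g \<xi>) = g \<xi> * \<phi> 1 = g \<xi>\<close>.
\<close>

theorem polyfun_value_in_subfield:
  fixes I :: "'i set" and V :: "'b set" and \<xi> :: "'i \<Rightarrow> 'b"
  assumes I: "finite I" and V: "finite V" and d: "\<And>i. d i \<in> K"
    and red: "\<And>v. v \<in> V \<Longrightarrow> v ^ card V = (\<Sum>i<card V. d i * v ^ i)"
    and \<xi>: "\<And>i. i \<in> I \<Longrightarrow> \<xi> i \<in> V"
    and g: "g \<in> polyfuns K I" and R: "R \<subseteq> polyfuns K I" "\<And>r. r \<in> R \<Longrightarrow> r \<xi> = 0"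
    and gR: "\<And>z. z \<in> PiE I (\<lambda>_. V) \<Longrightarrow> (\<And>r. r \<in> R \<Longrightarrow> r z = 0) \<Longrightarrow> g z = g \<xi>"
  shows "g \<xi> \<in> K"
proof (cases "V = {}")
  case True
  then have "I = {}" using \<xi> by auto
  have "f \<xi> \<in> K" if "f \<in> polyfuns K I" for f
    using that by induction (auto simp: \<open>I = {}\<close> add_mem mult_mem)
  then show ?thesis using g .
next
  case ne: False
  define Q where "Q = card V"
  define A where "A = PiE I (\<lambda>_. {..<Q})"
  define E where "E = PiE I (\<lambda>_. V)"
  define Y where "Y = restrict \<xi> I"
  have fin: "finite A" "finite E" using I V by (simp_all add: A_def E_def finite_PiE)
  have Y: "Y \<in> E" using \<xi> by (auto simp: Y_def E_def)
  have XY: "f \<xi> = f Y" if "f \<in> polyfuns K I" for f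
    by (rule polyfuns_cong[OF that]) (simp add: Y_def)
  obtain \<phi> where \<phi>: "\<And>x. \<phi> x \<in> K" "\<And>x y. \<phi> (x + y) = \<phi> x + \<phi> y"
    "\<And>c x. c \<in> K \<Longrightarrow> \<phi> (c * x) = c * \<phi> x" "\<phi> 1 = 1"
    by (rule exists_linear_retraction) blast
  have \<phi>0: "\<phi> 0 = 0" using \<phi>(3)[OF zero_mem, of 0] by simp
  have \<phi>_sum: "\<phi> (sum h B) = (\<Sum>b\<in>B. \<phi> (h b))" for h and B :: "'s set"
    by (induction B rule: infinite_finite_induct) (auto simp: \<phi>0 \<phi>(2))
  obtain \<eta> where \<eta>1: "\<And>t v. t \<in> V \<Longrightarrow> v \<in> V \<Longrightarrow> (\<Sum>a<Q. \<eta> a v * t ^ a) = (if t = v then 1 else 0)"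
    and \<eta>2: "\<And>a b. a < Q \<Longrightarrow> b < Q \<Longrightarrow> (\<Sum>v\<in>V. \<eta> a v * v ^ b) = (if a = b then 1 else 0)"
    unfolding Q_def by (rule lagrange_coefficients[OF V]) blast
  have delta: "(\<Prod>i\<in>I. if a i = b i then 1 else 0) = (if a = b then 1 else (0 :: 'b))"
    if ab: "a \<in> PiE I B" "b \<in> PiE I B" for a b :: "'i \<Rightarrow> 's" and B
  proof (cases "a = b")
    case False
    then obtain i where "i \<in> I" "a i \<noteq> b i" using PiE_ext[OF ab] by blast
    then show ?thesis using False I by (auto simp: prod_zero_iff)
  qed simp
  define w where "w z = (\<Sum>a\<in>A. \<phi> (\<Prod>i\<in>I. Y i ^ a i) * (\<Prod>i\<in>I. \<eta> (a i) (z i)))" for z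
  \<comment> \<open>Orthogonality of \<open>\<eta>\<close> makes \<open>w\<close> represent the functional on the reduced monomials.\<close>
  have w_mono: "(\<Sum>z\<in>E. w z * (\<Prod>i\<in>I. z i ^ b i)) = \<phi> (\<Prod>i\<in>I. Y i ^ b i)" if b: "b \<in> A" for b
  proof -
    have "(\<Sum>z\<in>E. w z * (\<Prod>i\<in>I. z i ^ b i)) =
      (\<Sum>z\<in>E. \<Sum>a\<in>A. \<phi> (\<Prod>i\<in>I. Y i ^ a i) * (\<Prod>i\<in>I. \<eta> (a i) (z i) * z i ^ b i))"
      by (simp add: w_def sum_distrib_right prod.distrib mult.assoc)
    also have "\<dots> = (\<Sum>a\<in>A. \<phi> (\<Prod>i\<in>I. Y i ^ a i) * (\<Sum>z\<in>E. \<Prod>i\<in>I. \<eta> (a i) (z i) * z i ^ b i))"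
      by (subst sum.swap) (simp add: sum_distrib_left)
    also have "\<dots> = (\<Sum>a\<in>A. \<phi> (\<Prod>i\<in>I. Y i ^ a i) * (if a = b then 1 else 0))"
    proof (rule sum.cong[OF refl])
      fix a assume a: "a \<in> A"
      have "(\<Sum>z\<in>E. \<Prod>i\<in>I. \<eta> (a i) (z i) * z i ^ b i) = (\<Prod>i\<in>I. \<Sum>v\<in>V. \<eta> (a i) v * v ^ b i)"
        unfolding E_def by (rule prod_sum_PiE[symmetric]) (use I V in auto)
      also have "\<dots> = (\<Prod>i\<in>I. if a i = b i then 1 else 0)"
        by (rule prod.cong[OF refl], rule \<eta>2) (use a b in \<open>auto simp: A_def\<close>)
      also have "\<dots> = (if a = b then 1 else 0)"
        by (rule delta) (use a b in \<open>auto simp: A_def\<close>)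
      finally show "\<phi> (\<Prod>i\<in>I. Y i ^ a i) * (\<Sum>z\<in>E. \<Prod>i\<in>I. \<eta> (a i) (z i) * z i ^ b i) =
        \<phi> (\<Prod>i\<in>I. Y i ^ a i) * (if a = b then 1 else 0)" by simp
    qed
    also have "\<dots> = \<phi> (\<Prod>i\<in>I. Y i ^ b i)"
      using fin(1) b by (simp add: if_distrib[of "\<lambda>x. _ * x"] cong: if_cong)
    finally show ?thesis .
  qed
  have w: "(\<Sum>z\<in>E. w z * f z) = \<phi> (f Y)" if f: "f \<in> polyfuns K I" for f
  proof -
    obtain \<rho> where \<rho>: "\<And>a. \<rho> a \<in> K"
      and fz: "\<And>z. z \<in> E \<Longrightarrow> f z = (\<Sum>a\<in>A. \<rho> a * (\<Prod>i\<in>I. z i ^ a i))"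
      using polyfuns_normal_form[OF I V ne d red f] unfolding E_def A_def Q_def by blast
    have "(\<Sum>z\<in>E. w z * f z) = (\<Sum>z\<in>E. \<Sum>a\<in>A. \<rho> a * (w z * (\<Prod>i\<in>I. z i ^ a i)))"
      by (rule sum.cong) (simp_all add: fz sum_distrib_left algebra_simps)
    also have "\<dots> = (\<Sum>a\<in>A. \<rho> a * (\<Sum>z\<in>E. w z * (\<Prod>i\<in>I. z i ^ a i)))"
      by (subst sum.swap) (simp add: sum_distrib_left)
    also have "\<dots> = (\<Sum>a\<in>A. \<phi> (\<rho> a * (\<Prod>i\<in>I. Y i ^ a i)))"
      by (rule sum.cong) (simp_all add: w_mono \<phi>(3) \<rho>)
    also have "\<dots> = \<phi> (f Y)" by (simp add: fz[OF Y] \<phi>_sum)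
    finally show ?thesis .
  qed
  \<comment> \<open>The indicator function of \<open>z\<close> is expanded into monomials by means of \<open>\<eta>\<close>.\<close>
  have supp: "w z = 0" if z: "z \<in> E" and r: "r \<in> R" "r z \<noteq> 0" for z r
  proof -
    have rp: "r \<in> polyfuns K I" using r R by blast
    have rY: "r Y = 0" using R(2)[OF r(1)] XY[OF rp] by simp
    have "w z * r z = (\<Sum>y\<in>E. w y * r y * (if y = z then 1 else 0))"
      using fin(2) z by (simp add: if_distrib[of "\<lambda>x. _ * x"] cong: if_cong)
    also have "\<dots> = (\<Sum>y\<in>E. \<Sum>a\<in>A. (\<Prod>i\<in>I. \<eta> (a i) (z i)) * (w y * (r y * (\<Prod>i\<in>I. y i ^ a i))))"
    proof (rule sum.cong[OF refl])
      fix y assume y: "y \<in> E"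
      have "(if y = z then 1 else 0) = (\<Prod>i\<in>I. if y i = z i then 1 else (0 :: 'b))"
        by (rule delta[symmetric]) (use y z in \<open>auto simp: E_def\<close>)
      also have "\<dots> = (\<Prod>i\<in>I. \<Sum>a<Q. \<eta> a (z i) * y i ^ a)"
        by (rule prod.cong[OF refl], rule \<eta>1[symmetric]) (use y z in \<open>auto simp: E_def\<close>)
      also have "\<dots> = (\<Sum>a\<in>A. \<Prod>i\<in>I. \<eta> (a i) (z i) * y i ^ a i)"
        unfolding A_def by (rule prod_sum_PiE) (use I in auto)
      finally show "w y * r y * (if y = z then 1 else 0) =
          (\<Sum>a\<in>A. (\<Prod>i\<in>I. \<eta> (a i) (z i)) * (w y * (r y * (\<Prod>i\<in>I. y i ^ a i))))"
        by (simp only: sum_distrib_left prod.distrib mult_ac)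
    qed
    also have "\<dots> = (\<Sum>a\<in>A. (\<Prod>i\<in>I. \<eta> (a i) (z i)) * (\<Sum>y\<in>E. w y * (r y * (\<Prod>i\<in>I. y i ^ a i))))"
      by (subst sum.swap) (simp add: sum_distrib_left)
    also have "\<dots> = (\<Sum>a\<in>A. (\<Prod>i\<in>I. \<eta> (a i) (z i)) * \<phi> (r Y * (\<Prod>i\<in>I. Y i ^ a i)))"
      by (subst w) (auto intro!: polyfuns_mult rp polyfuns_prod polyfuns_power polyfuns_coord)
    also have "\<dots> = 0" by (simp add: rY \<phi>0)
    finally show ?thesis using r by simp
  qed
  have "\<phi> (g Y) = (\<Sum>z\<in>E. w z * g z)" using w[OF g] by simp
  also have "\<dots> = (\<Sum>z\<in>E. w z * g Y)"
  proof (rule sum.cong[OF refl])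
    fix z assume z: "z \<in> E"
    show "w z * g z = w z * g Y"
    proof (cases "\<exists>r\<in>R. r z \<noteq> 0")
      case True
      then show ?thesis using supp z by auto
    next
      case False
      then show ?thesis using gR[of z] z XY[OF g] by (auto simp: E_def)
    qed
  qed
  also have "\<dots> = g Y"
    using w[OF polyfuns_const[OF one_mem]] by (simp add: \<phi>(4) flip: sum_distrib_right)
  finally show ?thesis using \<phi>(1)[of "g Y"] XY[OF g] by simp
qed

end


section \<open>The Frobenius map over a finite field\<close>

lemma power_CARD_eq:
  fixes x :: "'a :: {field, finite}"
  shows "x ^ CARD('a) = x"
proof (cases "x = 0")
  case False
  let ?U = "UNIV - {0 :: 'a}"
  have "(\<Prod>y\<in>?U. x * y) = \<Prod>?U"
    by (rule prod.reindex_bij_witness[of _ "\<lambda>y. y / x" "\<lambda>y. x * y"]) (use False in auto)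
  then have "x ^ card ?U * \<Prod>?U = 1 * \<Prod>?U" by (simp only: prod.distrib prod_constant mult_1)
  then have "x ^ card ?U = 1" by (subst (asm) mult_right_cancel) auto
  moreover have "CARD('a) = Suc (card ?U)" by (rule card_Suc_Diff1[symmetric]) auto
  ultimately show ?thesis by (metis mult_1_right power_Suc)
qed simp

lemma power_CARD_power_eq: "(x :: 'a :: {field, finite}) ^ (CARD('a) ^ k) = x"
  by (induction k) (simp_all add: power_mult power_CARD_eq)

lemma CARD_field_gt_1: "CARD('a :: {field, finite}) > 1"
proof -
  have "card {0, 1 :: 'a} \<le> CARD('a)" by (rule card_mono) auto
  then show ?thesis by simp
qed

text \<open>
  The polynomial \<open>(t + 1) ^ q - t ^ q - 1\<close> has degree less than \<open>q = CARD('a)\<close> but vanishes on all of \<open>'a\<close>,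
  so it is \<open>0\<close>. This gives additivity of the \<open>q\<close>-th power in every extension, without writing \<open>q\<close> as a
  power of the characteristic.
\<close>

lemma of_nat_CARD_choose:
  assumes "0 < i" "i < CARD('a :: {field, finite})"
  shows "of_nat (CARD('a) choose i) = (0 :: 'a)"
proof -
  let ?q = "CARD('a)"
  define p :: "'a poly" where "p = (\<Sum>i\<in>{1..<?q}. monom (of_nat (?q choose i)) i)"
  have "poly p x = 0" for x
  proof -
    have "x + 1 = (x + 1) ^ ?q" by (simp add: power_CARD_eq)
    also have "\<dots> = (\<Sum>i\<le>?q. of_nat (?q choose i) * x ^ i)"
      by (simp add: binomial_ring)
    also have "{..?q} = insert 0 (insert ?q {1..<?q})"
      using CARD_field_gt_1[where 'a = 'a] by auto
    also have "(\<Sum>i\<in>\<dots>. of_nat (?q choose i) * x ^ i) = 1 + x + poly p x"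
      using CARD_field_gt_1[where 'a = 'a]
      by (simp add: p_def poly_sum poly_monom power_CARD_eq add.assoc)
    finally show ?thesis by simp
  qed
  moreover have "degree p < CARD('a)"
  proof -
    have "degree p \<le> ?q - 1" unfolding p_def
      by (rule degree_sum_le) (auto intro!: order.trans[OF degree_monom_le])
    then show ?thesis using assms by linarith
  qed
  ultimately have "p = 0"
    using assms by (intro poly_eqI_degree[where A = UNIV]) auto
  moreover have "coeff p i = of_nat (?q choose i)"
    using assms by (simp add: p_def coeff_sum)
  ultimately show ?thesis by simp
qed

lemma Const_of_nat: "Const (of_nat m) = of_nat m"
  by (induction m) (simp_all add: Const.c_zero Const.c_add Const.c_one)

lemma Const_minus: "Const (- c) = - Const c"
  using Const.c_add[of c "- c"] by (simp add: Const.c_zero eq_neg_iff_add_eq_0 add.commute)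

lemma Const_diff: "Const (c - d) = Const c - Const d"
  using Const.c_add[of c "- d"] by (simp add: Const_minus)

lemma Const_power: "Const (c ^ k) = Const c ^ k"
  by (induction k) (simp_all add: Const.c_one Const.c_mult)

lemma Const_sum: "Const (sum f A) = (\<Sum>a\<in>A. Const (f a))"
  by (induction A rule: infinite_finite_induct) (simp_all add: Const.c_zero Const.c_add)

lemma Const_power_CARD: "Const (c :: 'a :: {field, finite}) ^ (CARD('a) ^ k) = Const c"
  by (simp add: power_CARD_power_eq flip: Const_power)

lemma frobenius_add:
  fixes x y :: "'a :: {field, finite} ratfun"
  shows "(x + y) ^ (CARD('a) ^ k) = x ^ (CARD('a) ^ k) + y ^ (CARD('a) ^ k)"
proof (induction k)
  case (Suc k)
  have *: "(u + v) ^ CARD('a) = u ^ CARD('a) + v ^ CARD('a)" for u v :: "'a ratfun"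
  proof -
    have "(u + v) ^ CARD('a) = (\<Sum>i\<le>CARD('a). of_nat (CARD('a) choose i) * u ^ i * v ^ (CARD('a) - i))"
      by (rule binomial_ring)
    also have "\<dots> = (\<Sum>i\<in>{0, CARD('a)}. of_nat (CARD('a) choose i) * u ^ i * v ^ (CARD('a) - i))"
    proof (rule sum.mono_neutral_right)
      show "\<forall>i\<in>{..CARD('a)} - {0, CARD('a)}. of_nat (CARD('a) choose i) * u ^ i * v ^ (CARD('a) - i) = 0"
      proof
        fix i assume "i \<in> {..CARD('a)} - {0, CARD('a)}"
        then have "0 < i" "i < CARD('a)" by auto
        then have "(of_nat (CARD('a) choose i) :: 'a ratfun) = Const 0"
          by (simp only: of_nat_CARD_choose flip: Const_of_nat)
        then show "of_nat (CARD('a) choose i) * u ^ i * v ^ (CARD('a) - i) = 0"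
          by (simp add: Const.c_zero)
      qed
    qed auto
    also have "\<dots> = u ^ CARD('a) + v ^ CARD('a)" by simp
    finally show ?thesis .
  qed
  show ?case
    by (simp add: power_mult mult.commute[of "CARD('a)"] Suc *)
qed simp

lemma frobenius_sum:
  fixes f :: "'s \<Rightarrow> 'a :: {field, finite} ratfun"
  shows "(\<Sum>a\<in>A. f a) ^ (CARD('a) ^ k) = (\<Sum>a\<in>A. f a ^ (CARD('a) ^ k))"
  by (induction A rule: infinite_finite_induct) (simp_all add: frobenius_add)

section \<open>Linear forms and the Moore matrix\<close>

definition linform :: "nat \<Rightarrow> (nat \<Rightarrow> 'a :: field) \<Rightarrow> 'a ratfun" where
  "linform N c = (\<Sum>i<N. Const (c i) * Xvar i)"

lemma linform_diff: "linform N a - linform N b = linform N (\<lambda>i. a i - b i)"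
  by (simp add: linform_def Const_diff left_diff_distrib sum_subtractf)

lemma to_fract_sum: "to_fract (sum f A) = (\<Sum>a\<in>A. to_fract (f a))"
  by (induction A rule: infinite_finite_induct) simp_all

lemma single_exponent_eq_iff:
  "Poly_Mapping.single i (Suc 0) = Poly_Mapping.single j (Suc 0) \<longleftrightarrow> i = j"
proof
  assume "Poly_Mapping.single i (Suc 0) = Poly_Mapping.single j (Suc 0)"
  then have "Poly_Mapping.lookup (Poly_Mapping.single i (Suc 0)) j = Suc 0" by simp
  then show "i = j" by (simp add: lookup_single when_def split: if_splits)
qed simp

lemma linform_eq_0D:
  assumes "linform N c = 0" "i < N"
  shows "c i = 0"
proof -
  have "linform N c = to_fract (\<Sum>j<N. Cpol (c j) * Xpol j)"
    by (simp add: linform_def to_fract_sum Const_def Xvar_def)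
  then have "(\<Sum>j<N. Cpol (c j) * Xpol j) = 0" using assms(1) by (metis to_fract_eq_0_iff)
  then have "0 = Poly_Mapping.lookup (\<Sum>j<N. Cpol (c j) * Xpol j) (Poly_Mapping.single i 1)"
    by simp
  also have "\<dots> = (\<Sum>j<N. c j when j = i)"
    by (simp add: lookup_sum Cpol_def Xpol_def mult_single lookup_single single_exponent_eq_iff)
  also have "\<dots> = c i" using assms(2) by (simp add: when_def)
  finally show ?thesis by simp
qed

lemma linform_inj:
  assumes "linform N a = linform N b" "i < N"
  shows "a i = b i"
  using linform_eq_0D[of N "\<lambda>i. a i - b i" i] assms by (simp flip: linform_diff)

lemma linform_frobenius:
  fixes c :: "nat \<Rightarrow> 'a :: {field, finite}"
  shows "linform N c ^ (CARD('a) ^ k) = (\<Sum>i<N. Const (c i) * Xvar i ^ (CARD('a) ^ k))"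
  by (simp add: linform_def frobenius_sum power_mult_distrib Const_power_CARD)

definition linforms :: "nat \<Rightarrow> 'a :: {field, finite} ratfun set" where
  "linforms N = linform N ` PiE {..<N} (\<lambda>_. UNIV)"

lemma linformsE:
  assumes "v \<in> linforms N"
  obtains c where "v = linform N c"
  using assms by (auto simp: linforms_def)

lemma finite_linforms: "finite (linforms N)"
  by (simp add: linforms_def finite_PiE)

lemma card_linforms: "card (linforms N :: 'a :: {field, finite} ratfun set) = CARD('a) ^ N"
proof -
  have "inj_on (linform N) (PiE {..<N} (\<lambda>_. UNIV :: 'a set))"
  proof (rule inj_onI)
    fix a b :: "nat \<Rightarrow> 'a"
    assume ab: "a \<in> PiE {..<N} (\<lambda>_. UNIV)" "b \<in> PiE {..<N} (\<lambda>_. UNIV)" "linform N a = linform N b"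
    show "a = b" by (rule PiE_ext[OF ab(1,2)]) (use linform_inj[OF ab(3)] in auto)
  qed
  then show ?thesis by (simp add: linforms_def card_image card_PiE)
qed

lemma Xvar_in_linforms:
  assumes "j < N"
  shows "Xvar j \<in> linforms N"
proof -
  have "linform N (restrict (\<lambda>i. if i = j then 1 else 0) {..<N}) = (Xvar j :: 'a ratfun)"
  proof -
    have "linform N (restrict (\<lambda>i. if i = j then 1 else 0) {..<N}) =
        (\<Sum>i<N. if i = j then Xvar i else (0 :: 'a ratfun))"
      unfolding linform_def by (rule sum.cong) (auto simp: Const.c_one Const.c_zero)
    then show ?thesis using assms by simp
  qed
  then show ?thesis unfolding linforms_def by (metis image_eqI restrict_PiE_iff UNIV_I)
qed

lemma square_system_solvable:
  fixes A :: "nat \<Rightarrow> nat \<Rightarrow> 'b :: field"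
  assumes "\<And>c. (\<And>j. j < N \<Longrightarrow> (\<Sum>i<N. c i * A i j) = 0) \<Longrightarrow> (\<And>i. i < N \<Longrightarrow> c i = 0)"
  obtains c where "\<And>j. j < N \<Longrightarrow> (\<Sum>i<N. c i * A i j) = b j"
proof -
  define M where "M = mat N N (\<lambda>(j, i). A i j)"
  have M: "M \<in> carrier_mat N N" by (simp add: M_def)
  have mult: "(M *\<^sub>v v) $ j = (\<Sum>i<N. v $ i * A i j)" if "v \<in> carrier_vec N" "j < N" for v j
    using that by (simp add: M_def scalar_prod_def lessThan_atLeast0 mult.commute)
  have "det M \<noteq> 0"
  proof
    assume "det M = 0"
    then obtain v where v: "v \<in> carrier_vec N" "v \<noteq> 0\<^sub>v N" "M *\<^sub>v v = 0\<^sub>v N"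
      using det_0_iff_vec_prod_zero[OF M] by blast
    have "(\<Sum>i<N. v $ i * A i j) = 0" if "j < N" for j
      using mult[OF v(1) that] v(3) that by simp
    then have "v $ i = 0" if "i < N" for i
      using assms[of "\<lambda>i. v $ i"] that by blast
    then show False using v by (auto intro: eq_vecI)
  qed
  define v where "v = (1 / det M) \<cdot>\<^sub>v (adj_mat M *\<^sub>v vec N b)"
  note adj = adj_mat[OF M]
  have v: "v \<in> carrier_vec N" using adj(1) by (auto simp: v_def)
  have "M *\<^sub>v v = (1 / det M) \<cdot>\<^sub>v (M *\<^sub>v (adj_mat M *\<^sub>v vec N b))"
    unfolding v_def using M adj(1) by (simp add: mult_mat_vec[of _ N N])
  also have "M *\<^sub>v (adj_mat M *\<^sub>v vec N b) = det M \<cdot>\<^sub>v vec N b"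
    using M adj by (subst assoc_mult_mat_vec[symmetric, of _ N N _ N]) auto
  finally have "M *\<^sub>v v = vec N b" using \<open>det M \<noteq> 0\<close> by (simp add: smult_smult_assoc)
  then show thesis using that[of "\<lambda>i. v $ i"] mult[OF v] by simp
qed

text \<open>
  A relation between the rows of the Moore matrix \<open>(X\<^sub>j ^ q ^ i)\<close> is a polynomial \<open>\<Sum>i. c i * t ^ q ^ i\<close> of
  degree less than \<open>q ^ N\<close> which, by additivity of the Frobenius map, vanishes at all \<open>q ^ N\<close> linear
  forms.
\<close>

lemma moore_rows_independent:
  assumes "\<And>j. j < N \<Longrightarrow> (\<Sum>i<N. c i * Xvar j ^ (CARD('a) ^ i)) = (0 :: 'a :: {field, finite} ratfun)"
    and "l < N"
  shows "c l = 0"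
proof -
  let ?q = "CARD('a)"
  note q = CARD_field_gt_1[where 'a = 'a]
  define p where "p = (\<Sum>i<N. monom (c i) (?q ^ i))"
  have "poly p v = 0" if "v \<in> linforms N" for v
  proof -
    obtain a where v: "v = linform N a" using \<open>v \<in> linforms N\<close> linformsE by blast
    have "poly p v = (\<Sum>i<N. c i * (\<Sum>j<N. Const (a j) * Xvar j ^ (?q ^ i)))"
      by (simp add: p_def poly_sum poly_monom v linform_frobenius)
    also have "\<dots> = (\<Sum>j<N. Const (a j) * (\<Sum>i<N. c i * Xvar j ^ (?q ^ i)))"
      unfolding sum_distrib_left by (subst sum.swap) (simp add: mult_ac)
    also have "\<dots> = 0" using assms(1) by simp
    finally show ?thesis .
  qed
  moreover have "degree p < ?q ^ N"
  proof -
    have "degree p \<le> ?q ^ (N - 1)" unfolding p_def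
      by (rule degree_sum_le)
         (use q in \<open>auto intro!: order.trans[OF degree_monom_le] power_increasing\<close>)
    also have "\<dots> < ?q ^ N" using q assms(2) by (intro power_strict_increasing) auto
    finally show ?thesis .
  qed
  ultimately have "p = 0"
    using q by (intro poly_eqI_degree[where A = "linforms N"]) (auto simp: card_linforms)
  then have "coeff p (?q ^ l) = 0" by simp
  moreover have "coeff p (?q ^ l) = (\<Sum>i<N. if i = l then c i else 0)"
    unfolding p_def coeff_sum by (rule sum.cong) (use q in auto)
  ultimately show ?thesis using assms(2) by simp
qed

text \<open>
  The rows may start at exponent \<open>q ^ s\<close>: applying the \<open>q ^ s\<close>-th power to rows of the inverse of the
  Moore matrix gives rows of the inverse of the shifted one, which is therefore invertible, too.
\<close>

lemma moore_columns_independent: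
  assumes "\<And>i. i < N \<Longrightarrow> (\<Sum>j<N. Xvar j ^ (CARD('a) ^ (i + s)) * y j) = (0 :: 'a :: {field, finite} ratfun)"
    and "l < N"
  shows "y l = 0"
proof -
  let ?q = "CARD('a)"
  obtain c where c: "\<And>j. j < N \<Longrightarrow> (\<Sum>i<N. c i * Xvar j ^ (?q ^ i)) = (if j = l then 1 else (0 :: 'a ratfun))"
    by (rule square_system_solvable[of N "\<lambda>i j. Xvar j ^ (?q ^ i)" "\<lambda>j. if j = l then 1 else 0"])
       (auto intro: moore_rows_independent)
  have c': "(\<Sum>i<N. c i ^ (?q ^ s) * Xvar j ^ (?q ^ (i + s))) = (if j = l then 1 else 0)" if "j < N" for j
  proof -
    have "(\<Sum>i<N. c i ^ (?q ^ s) * Xvar j ^ (?q ^ (i + s))) = (\<Sum>i<N. c i * Xvar j ^ (?q ^ i)) ^ (?q ^ s)"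
      by (simp add: frobenius_sum power_mult_distrib power_add power_mult)
    also have "\<dots> = (if j = l then 1 else 0)" using c[OF that] CARD_field_gt_1[where 'a = 'a] by simp
    finally show ?thesis .
  qed
  have "y l = (\<Sum>j<N. (if j = l then 1 else 0) * y j)"
    using assms(2) by (simp add: if_distrib[of "\<lambda>x. x * _"] cong: if_cong)
  also have "\<dots> = (\<Sum>j<N. (\<Sum>i<N. c i ^ (?q ^ s) * Xvar j ^ (?q ^ (i + s))) * y j)"
    by (rule sum.cong) (simp_all add: c')
  also have "\<dots> = (\<Sum>i<N. c i ^ (?q ^ s) * (\<Sum>j<N. Xvar j ^ (?q ^ (i + s)) * y j))"
    unfolding sum_distrib_left sum_distrib_right by (subst sum.swap) (simp add: mult_ac)
  also have "\<dots> = 0" using assms(1) by simp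
  finally show ?thesis .
qed


section \<open>Generated fields and quotients of polynomials\<close>

lemma adjoin_Const: "Const c \<in> adjoin A"
  by (simp add: adjoin_def generate_field.incl)

lemma adjoin_incl: "a \<in> A \<Longrightarrow> a \<in> adjoin A"
  by (simp add: adjoin_def generate_field.incl)

lemma ring_of_type_algebra_a_inv:
  "a_inv (ring_of_type_algebra :: 'b :: field ring) x = - x"
proof -
  interpret R: Ring.field "ring_of_type_algebra :: 'b ring" by (rule field_from_type_algebra)
  show ?thesis by (rule R.minus_equality) (simp_all add: ring_of_type_algebra_def)
qed

lemma ring_of_type_algebra_m_inv:
  assumes "x \<noteq> 0"
  shows "m_inv (ring_of_type_algebra :: 'b :: field ring) x = inverse x"
  unfolding m_inv_def
proof (rule the_equality)
  show "inverse x \<in> carrier ring_of_type_algebra \<and>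
      x \<otimes>\<^bsub>ring_of_type_algebra\<^esub> inverse x = \<one>\<^bsub>ring_of_type_algebra\<^esub> \<and>
      inverse x \<otimes>\<^bsub>ring_of_type_algebra\<^esub> x = \<one>\<^bsub>ring_of_type_algebra\<^esub>"
    using assms by (simp add: ring_of_type_algebra_def)
  show "y = inverse x" if "y \<in> carrier ring_of_type_algebra \<and>
      x \<otimes>\<^bsub>ring_of_type_algebra\<^esub> y = \<one>\<^bsub>ring_of_type_algebra\<^esub> \<and>
      y \<otimes>\<^bsub>ring_of_type_algebra\<^esub> x = \<one>\<^bsub>ring_of_type_algebra\<^esub>" for y
    using that inverse_unique[of x y] by (simp add: ring_of_type_algebra_def)
qed

lemma adjoin_subfield: "subfield_set (adjoin A)"
proof
  have minus: "- x \<in> adjoin A" if "x \<in> adjoin A" for x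
    using generate_field.a_inv[OF that[unfolded adjoin_def]]
    by (simp add: adjoin_def ring_of_type_algebra_a_inv)
  have add: "x + y \<in> adjoin A" if "x \<in> adjoin A" "y \<in> adjoin A" for x y
    using generate_field.eng_add[OF that[unfolded adjoin_def]]
    by (simp add: adjoin_def) (simp add: ring_of_type_algebra_def)
  show "1 \<in> adjoin A" using adjoin_Const[of 1 A] by (simp add: Const.c_one)
  show "x - y \<in> adjoin A" if "x \<in> adjoin A" "y \<in> adjoin A" for x y
    using add[OF that(1) minus[OF that(2)]] by simp
  show "x * y \<in> adjoin A" if "x \<in> adjoin A" "y \<in> adjoin A" for x y
    using generate_field.eng_mult[OF that[unfolded adjoin_def]]
    by (simp add: adjoin_def) (simp add: ring_of_type_algebra_def)
  show "inverse x \<in> adjoin A" if x: "x \<in> adjoin A" for x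
  proof (cases "x = 0")
    case True
    then show ?thesis using x by simp
  next
    case False
    moreover have "\<zero>\<^bsub>ring_of_type_algebra\<^esub> = (0 :: 'a ratfun)" by (simp add: ring_of_type_algebra_def)
    ultimately show ?thesis using generate_field.m_inv[OF x[unfolded adjoin_def]]
      by (simp add: adjoin_def ring_of_type_algebra_m_inv)
  qed
qed

lemma adjoin_least:
  assumes "subfield_set E" "range Const \<subseteq> E" "A \<subseteq> E"
  shows "adjoin A \<subseteq> E"
proof
  interpret E: subfield_set E by fact
  fix x assume "x \<in> adjoin A"
  then have "x \<in> generate_field ring_of_type_algebra (range Const \<union> A)" by (simp add: adjoin_def)
  then show "x \<in> E"
  proof induction
    case one
    then show ?case by (simp add: ring_of_type_algebra_def E.one_mem)
  next
    case (incl h)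
    then show ?case using assms by blast
  next
    case (a_inv h)
    then show ?case by (simp add: ring_of_type_algebra_a_inv E.minus_mem)
  next
    case (m_inv h)
    moreover have "\<zero>\<^bsub>ring_of_type_algebra\<^esub> = (0 :: 'a ratfun)" by (simp add: ring_of_type_algebra_def)
    ultimately show ?case by (simp add: ring_of_type_algebra_m_inv E.inverse_mem)
  next
    case (eng_add h1 h2)
    then show ?case using E.add_mem by (simp add: ring_of_type_algebra_def)
  next
    case (eng_mult h1 h2)
    then show ?case using E.mult_mem by (simp add: ring_of_type_algebra_def)
  qed
qed

definition mpols :: "nat \<Rightarrow> 'a :: field mpol set" where
  "mpols n = {p. \<forall>m\<in>Poly_Mapping.keys p. Poly_Mapping.keys m \<subseteq> {..<n}}"

lemma mpols_Cpol: "Cpol c \<in> mpols n"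
  by (simp add: mpols_def Cpol_def)

lemma mpols_Xpol: "i < n \<Longrightarrow> Xpol i \<in> mpols n"
  by (simp add: mpols_def Xpol_def)

lemma mpols_zero: "0 \<in> mpols n"
  by (simp add: mpols_def)

lemma mpols_one: "1 \<in> mpols n"
  using mpols_Cpol[of 1 n] by (simp add: Cpol.c_one)

lemma mpols_add: "p \<in> mpols n \<Longrightarrow> r \<in> mpols n \<Longrightarrow> p + r \<in> mpols n"
  using Poly_Mapping.keys_add[of p r] by (auto simp: mpols_def)

lemma mpols_diff: "p \<in> mpols n \<Longrightarrow> r \<in> mpols n \<Longrightarrow> p - r \<in> mpols n"
  using keys_diff[of p r] by (auto simp: mpols_def)

lemma mpols_mult:
  assumes "p \<in> mpols n" "r \<in> mpols n"
  shows "p * r \<in> mpols n"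
proof -
  have "Poly_Mapping.keys m \<subseteq> {..<n}" if "m \<in> Poly_Mapping.keys (p * r)" for m
  proof -
    obtain a b where "m = a + b" "a \<in> Poly_Mapping.keys p" "b \<in> Poly_Mapping.keys r"
      using \<open>m \<in> Poly_Mapping.keys (p * r)\<close> Poly_Mapping.keys_mult[of p r] by blast
    then show ?thesis using assms Poly_Mapping.keys_add[of a b] by (fastforce simp: mpols_def)
  qed
  then show ?thesis by (simp add: mpols_def)
qed

lemma mpols_sum: "(\<And>a. a \<in> A \<Longrightarrow> f a \<in> mpols n) \<Longrightarrow> sum f A \<in> mpols n"
  by (induction A rule: infinite_finite_induct) (auto simp: mpols_zero mpols_add)

lemma mpols_prod: "(\<And>a. a \<in> A \<Longrightarrow> f a \<in> mpols n) \<Longrightarrow> prod f A \<in> mpols n"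
  by (induction A rule: infinite_finite_induct) (auto simp: mpols_one mpols_mult)

lemma mpols_power: "p \<in> mpols n \<Longrightarrow> p ^ k \<in> mpols n"
  by (induction k) (auto simp: mpols_one mpols_mult)

lemma mpols_eval:
  assumes "p \<in> mpols n" "\<And>i. i < n \<Longrightarrow> h i \<in> mpols n"
  shows "mpol_eval Cpol h p \<in> mpols n"
  unfolding mpol_eval_def using assms
  by (intro mpols_sum mpols_mult mpols_prod mpols_power mpols_Cpol) (auto simp: mpols_def)

lemma ratfun_field_quotient:
  assumes "f \<in> ratfun_field n"
  obtains a b where "a \<in> mpols n" "b \<in> mpols n" "b \<noteq> 0" "f = to_fract a / to_fract b"
proof -
  define E where "E = {to_fract a / to_fract b | a b. a \<in> mpols n \<and> b \<in> mpols n \<and> b \<noteq> (0 :: 'a mpol)}"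
  have EI: "x \<in> E" if "x = to_fract a / to_fract b" "a \<in> mpols n" "b \<in> mpols n" "b \<noteq> 0" for x a b
    using that by (auto simp: E_def)
  have "subfield_set E"
  proof
    show "1 \<in> E" by (rule EI[of _ 1 1]) (simp_all add: mpols_one)
  next
    fix x y assume "x \<in> E" "y \<in> E"
    then obtain a b c d where ab: "a \<in> mpols n" "b \<in> mpols n" "b \<noteq> 0" "x = to_fract a / to_fract b"
      and cd: "c \<in> mpols n" "d \<in> mpols n" "d \<noteq> 0" "y = to_fract c / to_fract d"
      by (auto simp: E_def)
    show "x * y \<in> E"
      by (rule EI[of _ "a * c" "b * d"]) (use ab cd in \<open>auto simp: mpols_mult\<close>)
    show "x - y \<in> E"
      by (rule EI[of _ "a * d - c * b" "b * d"])
         (use ab cd in \<open>auto simp: mpols_mult mpols_diff diff_frac_eq\<close>)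
  next
    fix x assume "x \<in> E"
    then obtain a b where ab: "a \<in> mpols n" "b \<in> mpols n" "b \<noteq> 0" "x = to_fract a / to_fract b"
      by (auto simp: E_def)
    show "inverse x \<in> E"
    proof (cases "a = 0")
      case True
      then show ?thesis by (intro EI[of _ 0 1]) (use ab in \<open>auto simp: mpols_zero mpols_one\<close>)
    next
      case False
      then show ?thesis by (intro EI[of _ b a]) (use ab in auto)
    qed
  qed
  moreover have "range Const \<subseteq> E"
    by (auto intro!: EI[of _ _ 1] simp: Const_def mpols_Cpol mpols_one)
  moreover have "Xvar ` {..<n} \<subseteq> E"
    by (auto intro!: EI[of _ _ 1] simp: Xvar_def mpols_Xpol mpols_one)
  ultimately have "ratfun_field n \<subseteq> E" unfolding ratfun_field_def by (rule adjoin_least)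
  then show thesis using assms that by (auto simp: E_def)
qed

section \<open>The action on polynomials\<close>

definition act :: "'a :: field mat \<Rightarrow> 'a mpol \<Rightarrow> 'a mpol" where
  "act T p = mpol_eval Cpol (var_image_pol T) p"

lemma to_fract_act: "to_fract (act T p) = mpol_eval Const (var_image T) p"
  by (simp add: act_def var_image_pol[abs_def] eval_Const_to_fract)

lemma sigma_to_fract: "T \<in> GL n \<Longrightarrow> sigma T (to_fract p) = to_fract (act T p)"
  by (simp add: to_fract_act to_fract_def[of p] sigma_Fract Const.eval_one)

lemma act_mpols: "T \<in> carrier_mat n n \<Longrightarrow> p \<in> mpols n \<Longrightarrow> act T p \<in> mpols n"
  unfolding act_def
  by (rule mpols_eval) (auto simp: var_image_pol_def intro!: mpols_sum mpols_mult mpols_Cpol mpols_Xpol)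

lemma Cpol_sum: "Cpol (sum f A) = (\<Sum>a\<in>A. Cpol (f a))"
  by (induction A rule: infinite_finite_induct) (simp_all add: Cpol.c_zero Cpol.c_add)

lemma act_act:
  assumes A: "A \<in> carrier_mat n n" and B: "B \<in> carrier_mat n n"
  shows "act A (act B p) = act (A * B) p"
proof -
  have "mpol_eval Cpol (var_image_pol A) (var_image_pol B j) = var_image_pol (A * B) j" for j
  proof (cases "j < n")
    case True
    have "mpol_eval Cpol (var_image_pol A) (var_image_pol B j) =
        (\<Sum>i<n. Cpol (B $$ (i, j)) * (\<Sum>l<n. Cpol (A $$ (l, i)) * Xpol l))"
      using A B True
      by (simp add: var_image_pol_def Cpol.eval_sum Cpol.eval_mult Cpol.eval_Cpol Cpol.eval_Xpol)
    also have "\<dots> = (\<Sum>l<n. Cpol (\<Sum>i<n. A $$ (l, i) * B $$ (i, j)) * Xpol l)"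
      unfolding sum_distrib_left Cpol_sum sum_distrib_right
      by (subst sum.swap) (simp add: Cpol.c_mult mult_ac)
    also have "\<dots> = var_image_pol (A * B) j"
      using A B True by (simp add: var_image_pol_def scalar_prod_def lessThan_atLeast0)
    finally show ?thesis .
  next
    case False
    then show ?thesis using A B by (simp add: var_image_pol_def Cpol.eval_Xpol)
  qed
  then show ?thesis by (simp add: act_def Cpol.eval_eval)
qed

lemma act_prod: "act T (prod f A) = (\<Prod>a\<in>A. act T (f a))"
  by (simp add: act_def Cpol.eval_prod)

lemma act_inj:
  assumes "T \<in> GL n"
  shows "inj (act T)"
proof (rule injI)
  fix p r assume eq: "act T p = act T r"
  have "act T p = act T (p - r) + act T r"
    unfolding act_def by (subst Cpol.eval_add[symmetric]) simp
  then have "act T (p - r) = 0" using eq by simp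
  then show "p = r" using eval_var_image_eq_0_iff[OF assms, of "p - r"] by (simp flip: to_fract_act)
qed

lemma act_one: "act (1\<^sub>m n) p = p"
proof -
  have "var_image_pol (1\<^sub>m n) j = (Xpol j :: 'a mpol)" for j
  proof (cases "j < n")
    case True
    have "(\<Sum>i<n. Cpol (1\<^sub>m n $$ (i, j)) * Xpol i) = (\<Sum>i<n. if i = j then Xpol i else (0 :: 'a mpol))"
      by (rule sum.cong) (use True in \<open>auto simp: Cpol.c_zero Cpol.c_one\<close>)
    then show ?thesis using True by (simp add: var_image_pol_def)
  qed (simp add: var_image_pol_def)
  then have "var_image_pol (1\<^sub>m n) = (Xpol :: nat \<Rightarrow> 'a mpol)" by (rule ext)
  then show ?thesis by (simp add: act_def eval_Cpol_Xpol)
qed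

lemma finite_carrier_mat: "finite (carrier_mat m n :: 'a :: finite mat set)"
proof (rule finite_subset)
  let ?I = "{..<m} \<times> {..<n}"
  show "finite (mat m n ` PiE ?I (\<lambda>_. UNIV :: 'a set))" by (intro finite_imageI finite_PiE) auto
  show "carrier_mat m n \<subseteq> mat m n ` PiE ?I (\<lambda>_. UNIV :: 'a set)"
  proof
    fix T :: "'a mat" assume "T \<in> carrier_mat m n"
    then have "T = mat m n (restrict (\<lambda>ij. T $$ ij) ?I)" by (intro eq_matI) auto
    then show "T \<in> mat m n ` PiE ?I (\<lambda>_. UNIV)" by (metis image_eqI restrict_PiE_iff UNIV_I)
  qed
qed

text \<open>
  An invariant quotient \<open>a / b\<close> is a quotient of invariant polynomials: multiply both by the members of
  the orbit of \<open>b\<close> other than \<open>b\<close>. The new denominator is the product of the orbit, hence invariant, and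
  so is the new numerator.
\<close>

lemma invariants_from_polynomial_invariants:
  fixes H :: "'a :: {field, finite} mat set"
  assumes H: "H \<subseteq> GL n" "1\<^sub>m n \<in> H" "\<And>A B. A \<in> H \<Longrightarrow> B \<in> H \<Longrightarrow> A * B \<in> H"
    and K: "subfield_set K"
    and inv: "\<And>p. p \<in> mpols n \<Longrightarrow> (\<And>T. T \<in> H \<Longrightarrow> act T p = p) \<Longrightarrow> to_fract p \<in> K"
  shows "invariant_field n H \<subseteq> K"
proof
  have carrier: "T \<in> carrier_mat n n" if "T \<in> H" for T using that H by (auto simp: GL_def)
  fix f assume f: "f \<in> invariant_field n H"
  then have "f \<in> ratfun_field n" and fT: "\<And>T. T \<in> H \<Longrightarrow> sigma T f = f"
    by (auto simp: invariant_field_def)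
  then obtain a b where ab: "a \<in> mpols n" "b \<in> mpols n" "b \<noteq> 0" and fab: "f = to_fract a / to_fract b"
    by (metis ratfun_field_quotient)
  define B where "B = (\<lambda>T. act T b) ` H"
  have "finite B" unfolding B_def
    by (rule finite_imageI, rule finite_subset[OF _ finite_carrier_mat]) (use carrier in blast)
  have bB: "b \<in> B" unfolding B_def using H(2) act_one by (metis image_eqI)
  have B_mpols: "c \<in> mpols n" if "c \<in> B" for c
    using that ab carrier act_mpols by (auto simp: B_def)
  have B_nonzero: "c \<noteq> 0" if "c \<in> B" for c
  proof -
    obtain T where T: "T \<in> H" "c = act T b" using \<open>c \<in> B\<close> by (auto simp: B_def)
    then have "to_fract c = 0 \<longleftrightarrow> b = 0"
      using eval_var_image_eq_0_iff[of T n b] H by (auto simp: to_fract_act)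
    then show ?thesis using ab by auto
  qed
  have B_perm: "act T ` B = B" if T: "T \<in> H" for T
  proof (rule endo_inj_surj[OF \<open>finite B\<close>])
    show "act T ` B \<subseteq> B"
      using T H(3) act_act[OF carrier[OF T] carrier] by (auto simp: B_def)
    show "inj_on (act T) B" using act_inj T H by (meson inj_on_subset subset_UNIV subsetD)
  qed
  have D: "act T (\<Prod>B) = \<Prod>B" if T: "T \<in> H" for T
  proof -
    have "act T (\<Prod>B) = prod id (act T ` B)"
      using act_inj[of T n] T H by (subst prod.reindex) (auto simp: act_prod intro: inj_on_subset)
    then show ?thesis by (simp add: B_perm[OF T])
  qed
  have D0: "\<Prod>B \<noteq> 0" using B_nonzero \<open>finite B\<close> by (simp add: prod_zero_iff)
  have "\<Prod>B = b * \<Prod>(B - {b})" using prod.remove[OF \<open>finite B\<close> bB, of "\<lambda>c. c"] by simp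
  then have fD: "f * to_fract (\<Prod>B) = to_fract (a * \<Prod>(B - {b}))"
    using ab by (simp add: fab)
  have "to_fract (\<Prod>B) \<in> K"
    by (rule inv) (use B_mpols D in \<open>auto intro: mpols_prod\<close>)
  moreover have "to_fract (a * \<Prod>(B - {b})) \<in> K"
  proof (rule inv)
    show "a * \<Prod>(B - {b}) \<in> mpols n" using ab B_mpols by (intro mpols_mult mpols_prod) auto
    fix T assume T: "T \<in> H"
    then have GL: "T \<in> GL n" using H by auto
    have "to_fract (act T (a * \<Prod>(B - {b}))) = sigma T (f * to_fract (\<Prod>B))"
      by (simp only: fD sigma_to_fract[OF GL])
    also have "\<dots> = f * to_fract (\<Prod>B)"
      by (simp add: sigma_mult[OF GL] sigma_to_fract[OF GL] fT[OF T] D[OF T])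
    finally show "act T (a * \<Prod>(B - {b})) = a * \<Prod>(B - {b})" by (simp only: fD to_fract_eq_iff)
  qed
  ultimately have "f * to_fract (\<Prod>B) / to_fract (\<Prod>B) \<in> K"
    unfolding fD using subfield_set.divide_mem[OF K] by blast
  then show "f \<in> K" using D0 by simp
qed

section \<open>The matrix S and its group\<close>

text \<open>
  The permutation whose matrix is \<open>S\<close>: it exchanges the two halves of the first \<open>2 * \<nu>\<close> indices and fixes
  the last one. All products with \<open>S\<close> become sums over one index.
\<close>

definition flip :: "nat \<Rightarrow> nat \<Rightarrow> nat" where
  "flip \<nu> i = (if i < \<nu> then i + \<nu> else if i < 2 * \<nu> then i - \<nu> else i)"

lemma flip_flip [simp]: "flip \<nu> (flip \<nu> i) = i"
  by (auto simp: flip_def)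

lemma flip_less_iff [simp]: "flip \<nu> i < 2 * \<nu> \<longleftrightarrow> i < 2 * \<nu>"
  by (auto simp: flip_def)

lemma flip_last [simp]: "flip \<nu> (2 * \<nu>) = 2 * \<nu>"
  by (simp add: flip_def)

lemma Jmat_carrier: "Jmat \<nu> \<in> carrier_mat (2 * \<nu>) (2 * \<nu>)"
  by (auto simp: Jmat_def)

lemma index_Jmat:
  assumes "i < 2 * \<nu>" "j < 2 * \<nu>"
  shows "Jmat \<nu> $$ (i, j) = (if j = flip \<nu> i then 1 else 0)"
  using assms by (auto simp: Jmat_def flip_def)

lemma sum_flip_swap:
  fixes x y :: "nat \<Rightarrow> 'b :: comm_semiring_0"
  shows "(\<Sum>i<2 * \<nu>. x i * y (flip \<nu> i)) = (\<Sum>i<2 * \<nu>. y i * x (flip \<nu> i))"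
  by (rule sum.reindex_bij_witness[of _ "flip \<nu>" "flip \<nu>"]) (auto intro: mult.commute)

lemma sum_flip_alternating:
  fixes x :: "nat \<Rightarrow> 'b :: comm_ring_1"
  assumes "(1 :: 'b) + 1 = 0"
  shows "(\<Sum>i<2 * \<nu>. x i * x (flip \<nu> i)) = 0"
proof -
  define f where "f i = x i * x (flip \<nu> i)" for i
  have f_flip: "f (flip \<nu> i) = f i" for i by (simp add: f_def mult.commute)
  have halves: "{..<\<nu>} \<union> {\<nu>..<2 * \<nu>} = {..<2 * \<nu>}" by (rule ivl_disj_un_one(2)) simp
  have "sum f {..<2 * \<nu>} = sum f {..<\<nu>} + sum f {\<nu>..<2 * \<nu>}"
    unfolding halves[symmetric] by (rule sum.union_disjoint) auto
  also have "sum f {\<nu>..<2 * \<nu>} = sum f {..<\<nu>}"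
    by (rule sum.reindex_bij_witness[of _ "flip \<nu>" "flip \<nu>"]) (auto simp: f_flip, auto simp: flip_def)
  also have "sum f {..<\<nu>} + sum f {..<\<nu>} = sum f {..<\<nu>} * (1 + 1)"
    by (simp only: distrib_left mult_1_right)
  also have "\<dots> = 0" by (simp only: assms mult_zero_right)
  finally show ?thesis by (simp only: f_def)
qed

lemma Ppol_eq: "Ppol \<nu> k = (\<Sum>i<2 * \<nu>. Xvar i * Xvar (flip \<nu> i) ^ (CARD('a) ^ k) :: 'a :: {field, finite} ratfun)"
proof -
  let ?x = "mat 1 (2 * \<nu>) (\<lambda>(_, i). Xvar i) :: 'a ratfun mat"
  have "(?x * Jmat \<nu>) $$ (0, j) = Xvar (flip \<nu> j)" if j: "j < 2 * \<nu>" for j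
  proof -
    have "(?x * Jmat \<nu>) $$ (0, j) = (\<Sum>i<2 * \<nu>. Xvar i * Jmat \<nu> $$ (i, j))"
      using j Jmat_carrier[of \<nu>, where 'a = "'a ratfun"] by (simp add: scalar_prod_def lessThan_atLeast0)
    also have "\<dots> = (\<Sum>i<2 * \<nu>. if i = flip \<nu> j then Xvar i else 0)"
      by (rule sum.cong) (use j in \<open>auto simp: index_Jmat\<close>)
    also have "\<dots> = Xvar (flip \<nu> j)" using j by simp
    finally show ?thesis .
  qed
  then have "Ppol \<nu> k = (\<Sum>j<2 * \<nu>. Xvar (flip \<nu> j) * Xvar j ^ (CARD('a) ^ k) :: 'a ratfun)"
    using Jmat_carrier[of \<nu>, where 'a = "'a ratfun"]
    by (simp add: Ppol_def scalar_prod_def lessThan_atLeast0 del: index_mult_mat(1))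
       (simp add: scalar_prod_def lessThan_atLeast0)
  also have "\<dots> = (\<Sum>i<2 * \<nu>. Xvar i * Xvar (flip \<nu> i) ^ (CARD('a) ^ k))"
    by (rule sum.reindex_bij_witness[of _ "flip \<nu>" "flip \<nu>"]) auto
  finally show ?thesis .
qed

context
  fixes \<nu> n :: nat
  assumes n: "n = 2 * \<nu> + 1"
begin

lemma flip_less_dim [simp]: "flip \<nu> i < n \<longleftrightarrow> i < n"
  using n by (auto simp: flip_def)

lemma Smat_carrier: "Smat \<nu> \<in> carrier_mat n n"
  unfolding Smat_def n by (intro four_block_carrier_mat Jmat_carrier) simp

lemma index_Smat:
  assumes "i < n" "j < n"
  shows "Smat \<nu> $$ (i, j) = (if j = flip \<nu> i then 1 else 0 :: 'a :: field)"
proof -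
  have "dim_row (Jmat \<nu> :: 'a mat) = 2 * \<nu>" "dim_col (Jmat \<nu> :: 'a mat) = 2 * \<nu>"
    using Jmat_carrier[of \<nu>, where 'a = 'a] by auto
  then show ?thesis using assms n
    by (auto simp: Smat_def index_Jmat) (auto simp: flip_def)
qed

lemma preserves_Smat_iff:
  fixes T :: "'a :: field mat"
  assumes T: "T \<in> carrier_mat n n"
  shows "T * Smat \<nu> * transpose_mat T = Smat \<nu> \<longleftrightarrow>
    (\<forall>i<n. \<forall>j<n. (\<Sum>k<n. T $$ (i, k) * T $$ (j, flip \<nu> k)) =
       (if j = flip \<nu> i then 1 else 0))"
proof -
  note S = Smat_carrier[where 'a = 'a]
  have TS: "(T * Smat \<nu>) $$ (i, l) = T $$ (i, flip \<nu> l)" if "i < n" "l < n" for i l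
  proof -
    have "(T * Smat \<nu>) $$ (i, l) = (\<Sum>k<n. T $$ (i, k) * Smat \<nu> $$ (k, l))"
      using that T S by (simp add: scalar_prod_def lessThan_atLeast0)
    also have "\<dots> = (\<Sum>k<n. if k = flip \<nu> l then T $$ (i, k) else 0)"
      by (rule sum.cong) (use that in \<open>auto simp: index_Smat\<close>)
    also have "\<dots> = T $$ (i, flip \<nu> l)" using that by simp
    finally show ?thesis .
  qed
  have entry: "(T * Smat \<nu> * transpose_mat T) $$ (i, j) = (\<Sum>k<n. T $$ (i, k) * T $$ (j, flip \<nu> k))"
    if "i < n" "j < n" for i j
  proof -
    have "(M * transpose_mat T) $$ (i, j) = (\<Sum>l<n. M $$ (i, l) * T $$ (j, l))"
      if "M \<in> carrier_mat n n" for M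
      using that \<open>i < n\<close> \<open>j < n\<close> T by (simp add: scalar_prod_def lessThan_atLeast0)
    then have "(T * Smat \<nu> * transpose_mat T) $$ (i, j) = (\<Sum>l<n. (T * Smat \<nu>) $$ (i, l) * T $$ (j, l))"
      using mult_carrier_mat[OF T S] by blast
    also have "\<dots> = (\<Sum>l<n. T $$ (i, flip \<nu> l) * T $$ (j, l))"
      by (rule sum.cong) (use that TS in auto)
    also have "\<dots> = (\<Sum>k<n. T $$ (i, k) * T $$ (j, flip \<nu> k))"
      by (rule sum.reindex_bij_witness[of _ "flip \<nu>" "flip \<nu>"]) auto
    finally show ?thesis .
  qed
  show ?thesis
  proof
    assume "T * Smat \<nu> * transpose_mat T = Smat \<nu>"
    then show "\<forall>i<n. \<forall>j<n. (\<Sum>k<n. T $$ (i, k) * T $$ (j, flip \<nu> k)) = (if j = flip \<nu> i then 1 else 0)"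
      using entry index_Smat[where 'a = 'a] by metis
  next
    assume *: "\<forall>i<n. \<forall>j<n. (\<Sum>k<n. T $$ (i, k) * T $$ (j, flip \<nu> k)) = (if j = flip \<nu> i then 1 else 0)"
    show "T * Smat \<nu> * transpose_mat T = Smat \<nu>"
      by (rule eq_matI) (use T S * entry index_Smat[where 'a = 'a] in \<open>simp_all del: index_mult_mat(1)\<close>)
  qed
qed

lemma Smat_mult_Smat: "Smat \<nu> * Smat \<nu> = (1\<^sub>m n :: 'a :: field mat)"
proof -
  note S = Smat_carrier[where 'a = 'a]
  have "(Smat \<nu> * Smat \<nu>) $$ (i, j) = (1\<^sub>m n :: 'a mat) $$ (i, j)" if "i < n" "j < n" for i j
  proof -
    have "(Smat \<nu> * Smat \<nu>) $$ (i, j) = (\<Sum>k<n. Smat \<nu> $$ (i, k) * (Smat \<nu> $$ (k, j) :: 'a))"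
      using that S by (simp add: scalar_prod_def lessThan_atLeast0)
    also have "\<dots> = (\<Sum>k<n. if k = flip \<nu> i then (if i = j then 1 else 0) else 0)"
      by (rule sum.cong) (use that in \<open>auto simp: index_Smat\<close>)
    also have "\<dots> = (1\<^sub>m n :: 'a mat) $$ (i, j)" using that by simp
    finally show ?thesis .
  qed
  then show ?thesis using S by (intro eq_matI) (simp_all del: index_mult_mat(1))
qed

text \<open>
  Invertibility of \<open>T\<close> comes for free: \<open>S\<close> is an involution, so \<open>S T\<^sup>t S\<close> is a right inverse of \<open>T\<close>.
\<close>

lemma Ps_Smat_iff:
  "T \<in> Ps n (Smat \<nu>) \<longleftrightarrow>
     T \<in> carrier_mat n n \<and> T * Smat \<nu> * transpose_mat T = (Smat \<nu> :: 'a :: field mat)"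
proof (intro iffI conjI; (elim conjE)?)
  note S = Smat_carrier[where 'a = 'a]
  assume T: "T \<in> carrier_mat n n" and eq: "T * Smat \<nu> * transpose_mat T = Smat \<nu>"
  let ?B = "Smat \<nu> * (transpose_mat T * Smat \<nu>)"
  have B: "?B \<in> carrier_mat n n" using T S by (intro mult_carrier_mat) auto
  have "T * ?B = T * Smat \<nu> * transpose_mat T * Smat \<nu>"
    using T S by (simp add: assoc_mult_mat[of _ n n _ n _ n])
  then have TB: "T * ?B = 1\<^sub>m n" by (simp add: eq Smat_mult_Smat)
  then have "?B * T = 1\<^sub>m n" by (rule mat_mult_left_right_inverse[OF T B])
  then have "invertible_mat T"
    using TB T B by (auto simp: invertible_mat_def inverts_mat_def intro!: exI[of _ ?B])
  then show "T \<in> Ps n (Smat \<nu>)" using T eq by (simp add: Ps_def GL_def)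
qed (auto simp: Ps_def GL_def)

lemma Ps_one: "1\<^sub>m n \<in> Ps n (Smat \<nu> :: 'a :: field mat)"
  using Smat_carrier[where 'a = 'a] by (simp add: Ps_Smat_iff)

lemma Ps_mult:
  assumes "A \<in> Ps n (Smat \<nu>)" "B \<in> Ps n (Smat \<nu> :: 'a :: field mat)"
  shows "A * B \<in> Ps n (Smat \<nu>)"
proof -
  note S = Smat_carrier[where 'a = 'a]
  have A: "A \<in> carrier_mat n n" and B: "B \<in> carrier_mat n n"
    and eqs: "A * Smat \<nu> * transpose_mat A = Smat \<nu>" "B * Smat \<nu> * transpose_mat B = Smat \<nu>"
    using assms by (auto simp: Ps_Smat_iff)
  have "A * B * Smat \<nu> * transpose_mat (A * B) = A * (B * Smat \<nu> * transpose_mat B) * transpose_mat A"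
    using A B S by (simp add: transpose_mult[of _ n n _ n] assoc_mult_mat[of _ n n _ n _ n] mult_carrier_mat[of _ n n _ n])
  also have "\<dots> = Smat \<nu>" by (simp only: eqs)
  finally show ?thesis using mult_carrier_mat[OF A B] Ps_Smat_iff by blast
qed

end


section \<open>Invariance of the generators\<close>

text \<open>
  The \<open>q ^ k\<close>-th power fixes the coefficients of a linear form over \<open>'a\<close>, so the sum is bilinear in the
  variables and their \<open>q ^ k\<close>-th powers. In the applications \<open>h\<close> is the permutation whose matrix is \<open>S\<close>.
\<close>

lemma linform_pairing:
  fixes T :: "nat \<Rightarrow> nat \<Rightarrow> 'a :: {field, finite}"
  shows "(\<Sum>i<n. linform n (T i) * linform n (T (h i)) ^ (CARD('a) ^ k)) =
    (\<Sum>l<n. \<Sum>m<n. Const (\<Sum>i<n. T i l * T (h i) m) * (Xvar l * Xvar m ^ (CARD('a) ^ k)))"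
proof -
  have "(\<Sum>i<n. linform n (T i) * linform n (T (h i)) ^ (CARD('a) ^ k)) =
    (\<Sum>i<n. \<Sum>l<n. \<Sum>m<n. Const (T i l * T (h i) m) * (Xvar l * Xvar m ^ (CARD('a) ^ k)))"
    unfolding linform_frobenius unfolding linform_def sum_product by (simp only: Const.c_mult mult_ac)
  also have "\<dots> = (\<Sum>l<n. \<Sum>i<n. \<Sum>m<n. Const (T i l * T (h i) m) * (Xvar l * Xvar m ^ (CARD('a) ^ k)))"
    by (rule sum.swap)
  also have "\<dots> = (\<Sum>l<n. \<Sum>m<n. \<Sum>i<n. Const (T i l * T (h i) m) * (Xvar l * Xvar m ^ (CARD('a) ^ k)))"
    by (rule sum.cong[OF refl], rule sum.swap)
  also have "\<dots> = (\<Sum>l<n. \<Sum>m<n. Const (\<Sum>i<n. T i l * T (h i) m) * (Xvar l * Xvar m ^ (CARD('a) ^ k)))"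
    by (simp add: Const_sum sum_distrib_right)
  finally show ?thesis .
qed

lemma var_image_linform:
  assumes "T \<in> carrier_mat n n" "j < n"
  shows "var_image T j = linform n (\<lambda>i. T $$ (i, j))"
  using assms by (simp add: var_image_def linform_def scalar_prod_def lessThan_atLeast0 mult.commute)

lemma sigma_zero: "T \<in> GL n \<Longrightarrow> sigma T 0 = 0"
  using sigma_Const[of T n 0] by (simp add: Const.c_zero)

lemma sigma_one: "T \<in> GL n \<Longrightarrow> sigma T 1 = 1"
  using sigma_Const[of T n 1] by (simp add: Const.c_one)

lemma sigma_sum: "T \<in> GL n \<Longrightarrow> sigma T (sum f A) = (\<Sum>a\<in>A. sigma T (f a))"
  by (induction A rule: infinite_finite_induct) (simp_all add: sigma_zero sigma_add)

lemma sigma_power: "T \<in> GL n \<Longrightarrow> sigma T (f ^ k) = sigma T f ^ k"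
  by (induction k) (simp_all add: sigma_one sigma_mult)

lemma fixed_subfield:
  assumes T: "T \<in> GL n"
  shows "subfield_set {f. sigma T f = f}"
proof
  fix x y assume "x \<in> {f. sigma T f = f}" "y \<in> {f. sigma T f = f}"
  then have xy: "sigma T x = x" "sigma T y = y" by auto
  have "x = sigma T (x - y) + y" using sigma_add[OF T, of "x - y" y] by (simp add: xy)
  then have "sigma T (x - y) = x - y" by (metis add_diff_cancel_right')
  then show "x - y \<in> {f. sigma T f = f}" by simp
  show "x * y \<in> {f. sigma T f = f}" using xy by (simp add: sigma_mult[OF T])
next
  fix x assume "x \<in> {f. sigma T f = f}"
  then have x: "sigma T x = x" by simp
  show "inverse x \<in> {f. sigma T f = f}"
  proof (cases "x = 0")
    case True
    then show ?thesis by (simp add: sigma_zero[OF T])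
  next
    case False
    then have "x * sigma T (inverse x) = 1"
      using sigma_mult[OF T, of x "inverse x"] by (simp add: x sigma_one[OF T])
    then have "sigma T (inverse x) = inverse x" by (rule inverse_unique[symmetric])
    then show ?thesis by simp
  qed
qed (simp add: sigma_one[OF T])

context
  fixes \<nu> n :: nat
  assumes n: "n = 2 * \<nu> + 1"
begin

lemma sum_dim_split: "(\<Sum>i<n. f i) = (\<Sum>i<2 * \<nu>. f i) + (f (2 * \<nu>) :: 'b :: comm_monoid_add)"
  by (simp add: n)

text \<open>
  In characteristic two the form \<open>x S x\<^sup>t\<close> is \<open>x\<^sub>n\<^sup>2\<close>, since the other products occur twice. Preservation of
  the diagonal of \<open>S\<close> therefore determines the squares of the entries in the last column.
\<close>

lemma Ps_last_column:
  fixes T :: "'a :: field mat"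
  assumes char: "(1 :: 'a) + 1 = 0" and T: "T \<in> Ps n (Smat \<nu>)" and i: "i < n"
  shows "T $$ (i, 2 * \<nu>) = (if i = 2 * \<nu> then 1 else 0)"
proof -
  have "T \<in> carrier_mat n n" "T * Smat \<nu> * transpose_mat T = Smat \<nu>"
    using T by (auto simp: Ps_Smat_iff[OF n])
  then have "(\<Sum>k<n. T $$ (i, k) * T $$ (i, flip \<nu> k)) = (if i = flip \<nu> i then 1 else 0)"
    using i preserves_Smat_iff[OF n] by blast
  moreover have "i = flip \<nu> i \<longleftrightarrow> i = 2 * \<nu>" using i n by (auto simp: flip_def)
  ultimately have "T $$ (i, 2 * \<nu>) ^ 2 = (if i = 2 * \<nu> then 1 else 0)"
    using sum_flip_alternating[OF char, of "\<lambda>k. T $$ (i, k)" \<nu>]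
    by (simp add: sum_dim_split power2_eq_square)
  moreover have "- 1 = (1 :: 'a)" using char by (simp add: minus_equation_iff eq_neg_iff_add_eq_0)
  ultimately show ?thesis by (auto simp: power2_eq_1_iff split: if_splits)
qed

text \<open>
  The substitution preserves \<open>\<Sum>i<n. X\<^sub>i * X (flip i) ^ q ^ k\<close>, which is the generator with index \<open>k\<close> plus
  a power of the last variable. The last variable is fixed, so the generator is, too.
\<close>

lemma Ps_fixes_generators:
  fixes T :: "'a :: {field, finite} mat"
  assumes char: "(1 :: 'a) + 1 = 0" and T: "T \<in> Ps n (Smat \<nu>)"
  shows "sigma T (Xvar (2 * \<nu>)) = Xvar (2 * \<nu>)" "sigma T (Ppol \<nu> k) = Ppol \<nu> k"
proof -
  let ?q = "CARD('a)"
  have GL: "T \<in> GL n" using T by (simp add: Ps_def)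
  have carrier: "T \<in> carrier_mat n n" and eq: "T * Smat \<nu> * transpose_mat T = Smat \<nu>"
    using T by (auto simp: Ps_Smat_iff[OF n])
  define Y where "Y j = linform n (\<lambda>i. T $$ (i, j))" for j
  have sX: "sigma T (Xvar j) = Y j" if "j < n" for j
    using that by (simp add: sigma_Xvar[OF GL] var_image_linform[OF carrier] Y_def)
  have "Y (2 * \<nu>) = (\<Sum>i<n. if i = 2 * \<nu> then Xvar i else 0)"
    unfolding Y_def linform_def
    by (rule sum.cong) (simp_all add: Ps_last_column[OF char T] Const.c_one Const.c_zero)
  then have Y_last: "Y (2 * \<nu>) = Xvar (2 * \<nu>)" by (simp add: n)
  then show "sigma T (Xvar (2 * \<nu>)) = Xvar (2 * \<nu>)" by (simp add: sX n)
  have "(\<Sum>i<n. Y i * Y (flip \<nu> i) ^ (?q ^ k)) =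
      (\<Sum>l<n. \<Sum>m<n. Const (\<Sum>i<n. T $$ (l, i) * T $$ (m, flip \<nu> i)) * (Xvar l * Xvar m ^ (?q ^ k)))"
    unfolding Y_def by (rule linform_pairing)
  also have "\<dots> = (\<Sum>l<n. \<Sum>m<n. if m = flip \<nu> l then Xvar l * Xvar m ^ (?q ^ k) else 0)"
    using preserves_Smat_iff[OF n carrier] eq
    by (intro sum.cong refl) (auto simp: Const.c_one Const.c_zero)
  also have "\<dots> = (\<Sum>l<n. Xvar l * Xvar (flip \<nu> l) ^ (?q ^ k))"
    by (rule sum.cong) (simp_all add: flip_less_dim[OF n])
  finally have "(\<Sum>i<2 * \<nu>. Y i * Y (flip \<nu> i) ^ (?q ^ k)) = (\<Sum>l<2 * \<nu>. Xvar l * Xvar (flip \<nu> l) ^ (?q ^ k))"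
    by (simp add: sum_dim_split Y_last)
  moreover have "sigma T (Ppol \<nu> k) = (\<Sum>i<2 * \<nu>. Y i * Y (flip \<nu> i) ^ (?q ^ k))"
    unfolding Ppol_eq sigma_sum[OF GL]
    by (rule sum.cong) (simp_all add: sigma_mult[OF GL] sigma_power[OF GL] sX n)
  ultimately show "sigma T (Ppol \<nu> k) = Ppol \<nu> k" by (simp add: Ppol_eq)
qed

lemma adjoin_generators_invariant:
  assumes char: "(1 :: 'a :: {field, finite}) + 1 = 0"
  shows "adjoin (Ppol \<nu> ` {1..n - 1} \<union> {Xvar (n - 1)}) \<subseteq> invariant_field n (Ps n (Smat \<nu> :: 'a mat))"
proof -
  interpret R: subfield_set "ratfun_field n :: 'a ratfun set"
    unfolding ratfun_field_def by (rule adjoin_subfield)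
  have X: "(Xvar i :: 'a ratfun) \<in> ratfun_field n" if "i < n" for i
    unfolding ratfun_field_def using that by (intro adjoin_incl) auto
  have "adjoin (Ppol \<nu> ` {1..n - 1} \<union> {Xvar (n - 1)}) \<subseteq> (ratfun_field n :: 'a ratfun set)"
  proof (rule adjoin_least[OF R.subfield_set_axioms])
    show "range Const \<subseteq> (ratfun_field n :: 'a ratfun set)"
      by (auto simp: ratfun_field_def adjoin_Const)
    show "Ppol \<nu> ` {1..n - 1} \<union> {Xvar (n - 1)} \<subseteq> (ratfun_field n :: 'a ratfun set)"
    proof -
      have "Ppol \<nu> k \<in> (ratfun_field n :: 'a ratfun set)" for k
        unfolding Ppol_eq by (intro R.sum_mem R.mult_mem R.power_mem X) (use n in auto)
      moreover have "(Xvar (n - 1) :: 'a ratfun) \<in> ratfun_field n" using n by (intro X) simp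
      ultimately show ?thesis by blast
    qed
  qed
  moreover have "adjoin (Ppol \<nu> ` {1..n - 1} \<union> {Xvar (n - 1)}) \<subseteq> {f. sigma T f = f}"
    if T: "T \<in> Ps n (Smat \<nu> :: 'a mat)" for T
  proof -
    have GL: "T \<in> GL n" using T by (simp add: Ps_def)
    show ?thesis
      by (rule adjoin_least[OF fixed_subfield[OF GL]])
         (use Ps_fixes_generators[OF char T] in \<open>auto simp: sigma_Const[OF GL] n\<close>)
  qed
  ultimately show ?thesis by (auto simp: invariant_field_def)
qed

section \<open>Generation of the invariants\<close>

text \<open>
  The alternating form takes values in \<open>K\<close> on any two of the vectors \<open>(X\<^sub>j ^ q ^ i)\<^sub>j\<close> with
  \<open>i \<le> 2 * \<nu>\<close>: for different exponents the value is a Frobenius power of a generator, up to exchanging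
  the arguments, and for equal ones it is \<open>0\<close>.
\<close>

lemma gram_entry_mem:
  assumes char: "(1 :: 'a :: {field, finite}) + 1 = 0" and K: "subfield_set K"
    and P: "\<And>k. 1 \<le> k \<Longrightarrow> k \<le> 2 * \<nu> \<Longrightarrow> Ppol \<nu> k \<in> K"
    and il: "i \<le> 2 * \<nu>" "l \<le> 2 * \<nu>"
  shows "(\<Sum>j<2 * \<nu>. Xvar j ^ (CARD('a) ^ i) * Xvar (flip \<nu> j) ^ (CARD('a) ^ l) :: 'a ratfun) \<in> K"
proof -
  let ?q = "CARD('a)"
  interpret subfield_set K by fact
  let ?B = "\<lambda>i l. \<Sum>j<2 * \<nu>. Xvar j ^ (?q ^ i) * Xvar (flip \<nu> j) ^ (?q ^ l) :: 'a ratfun"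
  have less: "?B i l \<in> K" if "i < l" "l \<le> 2 * \<nu>" for i l
  proof -
    have "?q ^ l = ?q ^ (l - i) * ?q ^ i" using that by (simp flip: power_add)
    then have "?B i l = Ppol \<nu> (l - i) ^ (?q ^ i)"
      by (simp add: Ppol_eq frobenius_sum power_mult_distrib power_mult)
    then show ?thesis using that by (auto intro!: power_mem P)
  qed
  have "(1 :: 'a ratfun) + 1 = Const (1 + 1)" by (simp only: Const.c_add Const.c_one)
  then have char': "(1 :: 'a ratfun) + 1 = 0" by (simp only: char Const.c_zero)
  consider "i < l" | "i = l" | "l < i" by linarith
  then show ?thesis
  proof cases
    case 1
    then show ?thesis using less il by blast
  next
    case 2
    have "?B l l = 0" by (rule sum_flip_alternating[OF char'])
    then show ?thesis using 2 zero_mem by simp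
  next
    case 3
    have "?B i l = ?B l i" by (rule sum_flip_swap)
    then show ?thesis using less[OF 3 il(1)] by simp
  qed
qed

text \<open>
  The Moore matrix is invertible, so the row with exponent \<open>q ^ (2 * \<nu>)\<close> is a combination of its rows, with
  unique coefficients \<open>c\<close>. Pairing this relation with each row gives a linear system for \<open>c\<close> whose
  coefficients lie in \<open>K\<close>. The system is nonsingular, because the form is. A linear retraction \<open>\<phi>\<close> onto \<open>K\<close>
  maps \<open>c\<close> to another solution, whence \<open>\<phi> (c i) = c i\<close>.
\<close>

lemma frobenius_relation_coefficients:
  assumes char: "(1 :: 'a :: {field, finite}) + 1 = 0" and K: "subfield_set K"
    and P: "\<And>k. 1 \<le> k \<Longrightarrow> k \<le> 2 * \<nu> \<Longrightarrow> Ppol \<nu> k \<in> K"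
  shows "\<exists>c. (\<forall>i<2 * \<nu>. c i \<in> K) \<and> (\<forall>j<2 * \<nu>.
    (Xvar j :: 'a ratfun) ^ (CARD('a) ^ (2 * \<nu>)) = (\<Sum>i<2 * \<nu>. c i * Xvar j ^ (CARD('a) ^ i)))"
proof -
  let ?q = "CARD('a)" and ?N = "2 * \<nu>"
  interpret subfield_set K by fact
  let ?B = "\<lambda>i l. \<Sum>j<?N. Xvar j ^ (?q ^ i) * Xvar (flip \<nu> j) ^ (?q ^ l) :: 'a ratfun"
  obtain c where c: "\<And>j. j < ?N \<Longrightarrow> (\<Sum>i<?N. c i * Xvar j ^ (?q ^ i)) = (Xvar j :: 'a ratfun) ^ (?q ^ ?N)"
    by (rule square_system_solvable[of ?N "\<lambda>i j. Xvar j ^ (?q ^ i)" "\<lambda>j. Xvar j ^ (?q ^ ?N)"])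
       (auto intro: moore_rows_independent)
  obtain \<phi> where \<phi>: "\<And>x. \<phi> x \<in> K" "\<And>x y. \<phi> (x + y) = \<phi> x + \<phi> y"
    "\<And>c x. c \<in> K \<Longrightarrow> \<phi> (c * x) = c * \<phi> x" "\<phi> 1 = 1"
    by (rule exists_linear_retraction) blast
  have \<phi>0: "\<phi> 0 = 0" using \<phi>(3)[OF zero_mem, of 0] by simp
  have \<phi>_sum: "\<phi> (sum h A) = (\<Sum>a\<in>A. \<phi> (h a))" for h and A :: "nat set"
    by (induction A rule: infinite_finite_induct) (auto simp: \<phi>0 \<phi>(2))
  have \<phi>K: "\<phi> x = x" if "x \<in> K" for x using \<phi>(3)[OF that, of 1] \<phi>(4) by simp
  have \<phi>_right: "\<phi> (x * k) = \<phi> x * k" if "k \<in> K" for x k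
    using \<phi>(3)[OF that, of x] mult.commute[of x k] mult.commute[of "\<phi> x" k] by metis
  have B: "?B i l \<in> K" if "i \<le> ?N" "l \<le> ?N" for i l
    by (rule gram_entry_mem[OF char K P]) (use that in auto)
  have system: "(\<Sum>i<?N. c i * ?B i l) = ?B ?N l" for l
  proof -
    have "?B ?N l = (\<Sum>j<?N. (\<Sum>i<?N. c i * Xvar j ^ (?q ^ i)) * Xvar (flip \<nu> j) ^ (?q ^ l))"
      by (rule sum.cong) (simp_all add: c)
    then show ?thesis
      unfolding sum_distrib_right sum_distrib_left by (subst (asm) sum.swap) (simp add: mult_ac)
  qed
  define d where "d i = c i - \<phi> (c i)" for i
  have d_system: "(\<Sum>i<?N. d i * ?B i l) = 0" if "l < ?N" for l
  proof -
    have apply_\<phi>: "\<phi> (\<Sum>i<?N. c i * ?B i l) = (\<Sum>i<?N. \<phi> (c i) * ?B i l)"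
      unfolding \<phi>_sum by (rule sum.cong[OF refl], rule \<phi>_right, rule B) (use that in auto)
    have "\<phi> (\<Sum>i<?N. c i * ?B i l) = (\<Sum>i<?N. c i * ?B i l)"
      unfolding system by (rule \<phi>K, rule B) (use that in auto)
    then have "(\<Sum>i<?N. c i * ?B i l) - (\<Sum>i<?N. \<phi> (c i) * ?B i l) = 0"
      unfolding apply_\<phi> right_minus_eq by (rule sym)
    then show ?thesis by (simp only: d_def left_diff_distrib sum_subtractf)
  qed
  define y where "y j = (\<Sum>i<?N. d i * Xvar (flip \<nu> j) ^ (?q ^ i))" for j
  have y: "y j = 0" if "j < ?N" for j
  proof (rule moore_columns_independent[where N = ?N and s = 0, OF _ that])
    fix l assume l: "l < ?N"
    have "(\<Sum>j<?N. Xvar j ^ (?q ^ (l + 0)) * y j) =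
        (\<Sum>i<?N. d i * (\<Sum>j<?N. Xvar j ^ (?q ^ l) * Xvar (flip \<nu> j) ^ (?q ^ i)))"
      unfolding y_def sum_distrib_left by (subst sum.swap) (simp add: mult_ac)
    also have "\<dots> = (\<Sum>i<?N. d i * ?B i l)"
      by (subst sum_flip_swap) (rule refl)
    also have "\<dots> = 0" by (rule d_system[OF l])
    finally show "(\<Sum>j<?N. Xvar j ^ (?q ^ (l + 0)) * y j) = 0" .
  qed
  have "d i = 0" if "i < ?N" for i
  proof (rule moore_rows_independent[where N = ?N, OF _ that])
    fix j assume "j < ?N"
    then show "(\<Sum>i<?N. d i * Xvar j ^ (?q ^ i)) = 0" using y[of "flip \<nu> j"] by (simp add: y_def)
  qed
  then have "c i = \<phi> (c i)" if "i < ?N" for i using that unfolding d_def right_minus_eq .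
  then have cK: "c i \<in> K" if "i < ?N" for i using that \<phi>(1) by metis
  show ?thesis using cK c[symmetric] by blast
qed

text \<open>
  Let \<open>C\<close> be the difference between the transformed and the original matrix of the form. The hypothesis says that the row vector \<open>X C\<close> is
  orthogonal to the rows of the Moore matrix with exponents \<open>q, \<dots>, q ^ (2 * \<nu>)\<close>. That matrix is invertible,
  so \<open>X C = 0\<close>, and \<open>C = 0\<close> as its entries are constants.
\<close>

lemma symplectic_from_pairing:
  fixes a :: "nat \<Rightarrow> nat \<Rightarrow> 'a :: {field, finite}"
  assumes eq: "\<And>k. 1 \<le> k \<Longrightarrow> k \<le> 2 * \<nu> \<Longrightarrow>
    (\<Sum>i<2 * \<nu>. linform (2 * \<nu>) (a i) * linform (2 * \<nu>) (a (flip \<nu> i)) ^ (CARD('a) ^ k)) = Ppol \<nu> k"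
    and lm: "l < 2 * \<nu>" "m < 2 * \<nu>"
  shows "(\<Sum>i<2 * \<nu>. a i l * a (flip \<nu> i) m) = (if m = flip \<nu> l then 1 else 0)"
proof -
  let ?q = "CARD('a)" and ?N = "2 * \<nu>"
  define C where "C l m = (\<Sum>i<?N. a i l * a (flip \<nu> i) m) - (if m = flip \<nu> l then 1 else 0)" for l m
  have "linform ?N (\<lambda>l. C l m) = 0"
  proof (rule moore_columns_independent[where N = ?N and s = 1 and y = "\<lambda>m. linform ?N (\<lambda>l. C l m)", OF _ lm(2)])
    fix k assume k: "k < ?N"
    let ?k = "k + 1"
    have P: "(Ppol \<nu> ?k :: 'a ratfun) = (\<Sum>l<?N. \<Sum>m<?N. Const (if m = flip \<nu> l then 1 else 0) * (Xvar l * Xvar m ^ (?q ^ ?k)))"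
      unfolding Ppol_eq
    proof (rule sum.cong[OF refl])
      fix l assume l: "l \<in> {..<?N}"
      have "Xvar l * Xvar (flip \<nu> l) ^ (?q ^ ?k) =
          (\<Sum>m<?N. if m = flip \<nu> l then Xvar l * Xvar m ^ (?q ^ ?k) else (0 :: 'a ratfun))"
        using l by simp
      also have "\<dots> = (\<Sum>m<?N. Const (if m = flip \<nu> l then 1 else 0) * (Xvar l * Xvar m ^ (?q ^ ?k)))"
        by (rule sum.cong) (simp_all add: Const.c_one Const.c_zero)
      finally show "Xvar l * Xvar (flip \<nu> l) ^ (?q ^ ?k) =
          (\<Sum>m<?N. Const (if m = flip \<nu> l then 1 else 0) * (Xvar l * Xvar m ^ (?q ^ ?k)) :: 'a ratfun)" .
    qed
    have "(\<Sum>m<?N. Xvar m ^ (?q ^ ?k) * linform ?N (\<lambda>l. C l m)) =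
        (\<Sum>l<?N. \<Sum>m<?N. Const (C l m) * (Xvar l * Xvar m ^ (?q ^ ?k)))"
      unfolding linform_def sum_distrib_left by (subst sum.swap) (simp add: mult_ac)
    also have "\<dots> = (\<Sum>l<?N. \<Sum>m<?N. Const (\<Sum>i<?N. a i l * a (flip \<nu> i) m) * (Xvar l * Xvar m ^ (?q ^ ?k))) - Ppol \<nu> ?k"
      unfolding P C_def Const_diff left_diff_distrib sum_subtractf ..
    also have "\<dots> = 0"
      unfolding linform_pairing[symmetric] using eq[of ?k] k by simp
    finally show "(\<Sum>m<?N. Xvar m ^ (?q ^ (k + 1)) * linform ?N (\<lambda>l. C l m)) = 0" .
  qed
  then have "C l m = 0" using linform_eq_0D[of ?N "\<lambda>l. C l m"] lm by blast
  then show ?thesis by (simp add: C_def)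
qed

lemma symplectic_extension_in_Ps:
  fixes a :: "nat \<Rightarrow> nat \<Rightarrow> 'a :: field"
  assumes a: "\<And>l m. l < 2 * \<nu> \<Longrightarrow> m < 2 * \<nu> \<Longrightarrow>
    (\<Sum>i<2 * \<nu>. a i l * a (flip \<nu> i) m) = (if m = flip \<nu> l then 1 else 0)"
  shows "mat n n (\<lambda>(l, i). if l < 2 * \<nu> \<and> i < 2 * \<nu> then a i l else if l = i then 1 else 0) \<in> Ps n (Smat \<nu>)"
proof -
  define T where "T = mat n n (\<lambda>(l, i). if l < 2 * \<nu> \<and> i < 2 * \<nu> then a i l else if l = i then 1 else 0)"
  have carrier: "T \<in> carrier_mat n n" by (simp add: T_def)
  have inner: "T $$ (l, i) = a i l" if "l < 2 * \<nu>" "i < 2 * \<nu>" for l i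
    using that n by (simp add: T_def)
  have outer: "T $$ (2 * \<nu>, i) = (if i = 2 * \<nu> then 1 else 0)"
    "T $$ (i, 2 * \<nu>) = (if i = 2 * \<nu> then 1 else 0)" if "i < n" for i
    using that n by (auto simp: T_def)
  have cases_dim: "l < 2 * \<nu> \<or> l = 2 * \<nu>" if "l < n" for l using that n by auto
  have N: "2 * \<nu> < n" using n by simp
  have "(\<Sum>k<n. T $$ (l, k) * T $$ (m, flip \<nu> k)) = (if m = flip \<nu> l then 1 else 0)" if "l < n" "m < n" for l m
  proof -
    have flip_neq: "flip \<nu> l \<noteq> 2 * \<nu>" if "l < 2 * \<nu>" for l using that by (auto simp: flip_def)
    have "(\<Sum>k<2 * \<nu>. T $$ (l, k) * T $$ (m, flip \<nu> k)) =
        (if l < 2 * \<nu> \<and> m < 2 * \<nu> then if m = flip \<nu> l then 1 else 0 else 0)"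
    proof (cases "l < 2 * \<nu> \<and> m < 2 * \<nu>")
      case True
      then show ?thesis using a[of l m] by (simp add: inner)
    next
      case False
      then have "l = 2 * \<nu> \<or> m = 2 * \<nu>" using cases_dim \<open>l < n\<close> \<open>m < n\<close> by blast
      then have "T $$ (l, k) * T $$ (m, flip \<nu> k) = 0" if "k < 2 * \<nu>" for k
      proof -
        have "k < n" "k \<noteq> 2 * \<nu>" "flip \<nu> k < n" "flip \<nu> k \<noteq> 2 * \<nu>"
          using that n by (auto simp: flip_def)
        then show ?thesis using \<open>l = 2 * \<nu> \<or> m = 2 * \<nu>\<close> outer(1) by auto
      qed
      then have "(\<Sum>k<2 * \<nu>. T $$ (l, k) * T $$ (m, flip \<nu> k)) = 0" by (intro sum.neutral) simp
      then show ?thesis unfolding if_not_P[OF False] .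
    qed
    then show ?thesis
      using cases_dim[OF \<open>l < n\<close>] cases_dim[OF \<open>m < n\<close>] flip_neq outer[OF \<open>l < n\<close>] outer[OF \<open>m < n\<close>]
      by (auto simp: sum_dim_split)
  qed
  then show ?thesis
    unfolding Ps_Smat_iff[OF n] T_def[symmetric] using carrier preserves_Smat_iff[OF n carrier] by blast
qed

text \<open>
  This applies \<open>polyfun_value_in_subfield\<close> to the point \<open>(X\<^sub>1, \<dots>, X\<^bsub>2\<nu>\<^esub>)\<close>, the finite space \<open>V\<close> of linear forms, and
  the relations that prescribe the values of the generators. A common zero in the grid is a vector of linear
  forms, so it is \<open>X T\<close> for a matrix \<open>T\<close> over \<open>'a\<close>, and \<open>T\<close> is symplectic. Hence \<open>p\<close> takes there the value of
  \<open>act T p = p\<close>.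
\<close>

lemma invariant_polynomial_in_adjoin:
  fixes p :: "'a :: {field, finite} mpol"
  assumes char: "(1 :: 'a) + 1 = 0"
    and p: "p \<in> mpols n" and inv: "\<And>T. T \<in> Ps n (Smat \<nu>) \<Longrightarrow> act T p = p"
  shows "to_fract p \<in> adjoin (Ppol \<nu> ` {1..n - 1} \<union> {Xvar (n - 1)})"
proof -
  let ?q = "CARD('a)" and ?N = "2 * \<nu>" and ?V = "linforms (2 * \<nu>) :: 'a ratfun set"
  define K :: "'a ratfun set" where "K = adjoin (Ppol \<nu> ` {1..n - 1} \<union> {Xvar (n - 1)})"
  have K: "subfield_set K" unfolding K_def by (rule adjoin_subfield)
  interpret subfield_set K by (rule K)
  have P: "Ppol \<nu> k \<in> K" if "1 \<le> k" "k \<le> ?N" for k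
    unfolding K_def using that n by (intro adjoin_incl) auto
  have last: "Xvar ?N \<in> K" unfolding K_def using n by (intro adjoin_incl) auto
  have const: "Const c \<in> K" for c unfolding K_def by (rule adjoin_Const)
  obtain c where "(\<forall>i<?N. c i \<in> K) \<and>
      (\<forall>j<?N. (Xvar j :: 'a ratfun) ^ (?q ^ ?N) = (\<Sum>i<?N. c i * Xvar j ^ (?q ^ i)))"
    using frobenius_relation_coefficients[OF char K P] ..
  then have cK: "\<And>i. i < ?N \<Longrightarrow> c i \<in> K"
    and c: "\<And>j. j < ?N \<Longrightarrow> (Xvar j :: 'a ratfun) ^ (?q ^ ?N) = (\<Sum>i<?N. c i * Xvar j ^ (?q ^ i))"
    by blast+
  \<comment> \<open>The relation between Frobenius powers, as a polynomial of degree \<open>card V\<close> that vanishes on \<open>V\<close>.\<close>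
  define d where "d m = (\<Sum>i<?N. if m = ?q ^ i then c i else 0)" for m
  have dK: "d m \<in> K" for m unfolding d_def by (intro sum_mem) (auto simp: cK zero_mem)
  have reduction: "v ^ card ?V = (\<Sum>m<card ?V. d m * v ^ m)" if v: "v \<in> ?V" for v
  proof -
    obtain e where e: "v = linform ?N e" using v linformsE by blast
    have "v ^ card ?V = (\<Sum>j<?N. Const (e j) * (\<Sum>i<?N. c i * Xvar j ^ (?q ^ i)))"
      unfolding card_linforms e linform_frobenius by (rule sum.cong) (simp_all add: c)
    also have "\<dots> = (\<Sum>i<?N. c i * v ^ (?q ^ i))"
      unfolding e linform_frobenius sum_distrib_left by (subst sum.swap) (simp add: mult_ac)
    also have "\<dots> = (\<Sum>i<?N. \<Sum>m<card ?V. if m = ?q ^ i then c i * v ^ m else 0)"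
    proof (rule sum.cong[OF refl])
      fix i assume "i \<in> {..<?N}"
      then have "?q ^ i < card ?V"
        unfolding card_linforms using CARD_field_gt_1[where 'a = 'a] by (intro power_strict_increasing) auto
      then show "c i * v ^ (?q ^ i) = (\<Sum>m<card ?V. if m = ?q ^ i then c i * v ^ m else 0)" by simp
    qed
    also have "\<dots> = (\<Sum>m<card ?V. d m * v ^ m)"
      by (subst sum.swap) (auto simp: d_def sum_distrib_right intro!: sum.cong)
    finally show ?thesis .
  qed
  define g where "g z = mpol_eval Const (\<lambda>i. if i < ?N then z i else Xvar i) p" for z
  have gX: "g Xvar = to_fract p"
    unfolding g_def Xvar_def[abs_def] by (simp add: eval_Const_to_fract eval_Cpol_Xpol Xvar_def)
  have g: "g \<in> polyfuns K {..<?N}"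
  proof -
    have "(\<lambda>z. if i < ?N then z i else Xvar i) \<in> polyfuns K {..<?N}" if "i < n" for i
    proof (cases "i < ?N")
      case True
      then show ?thesis by (simp add: polyfuns_coord)
    next
      case False
      then have "i = ?N" using that n by simp
      then show ?thesis using polyfuns_const[OF last] by simp
    qed
    then show ?thesis unfolding g_def[abs_def] mpol_eval_def using p
      by (intro polyfuns_sum polyfuns_mult polyfuns_prod polyfuns_power polyfuns_const const)
         (auto simp: mpols_def)
  qed
  define r where "r k z = (\<Sum>i<?N. z i * z (flip \<nu> i) ^ (?q ^ k)) + - Ppol \<nu> k" for k and z :: "nat \<Rightarrow> 'a ratfun"
  have "g Xvar \<in> K"
  proof (rule polyfun_value_in_subfield[of "{..<?N}" ?V d Xvar g "r ` {1..?N}"])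
    show "Xvar i \<in> ?V" if "i \<in> {..<?N}" for i using that Xvar_in_linforms by auto
    show "r ` {1..?N} \<subseteq> polyfuns K {..<?N}"
      unfolding r_def[abs_def]
      by (intro image_subsetI polyfuns_add polyfuns_sum polyfuns_mult polyfuns_power polyfuns_const
          polyfuns_coord minus_mem P) auto
    show "f Xvar = 0" if "f \<in> r ` {1..?N}" for f
      using that by (auto simp: r_def Ppol_eq)
    fix z assume z: "z \<in> PiE {..<?N} (\<lambda>_. ?V)" and rz: "\<And>f. f \<in> r ` {1..?N} \<Longrightarrow> f z = 0"
    have "\<exists>e. z i = linform ?N e" if "i < ?N" for i
      using z that linformsE by blast
    then obtain a where a: "\<And>i. i < ?N \<Longrightarrow> z i = linform ?N (a i)" by metis
    have pair: "(\<Sum>i<?N. linform ?N (a i) * linform ?N (a (flip \<nu> i)) ^ (?q ^ k)) = Ppol \<nu> k"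
      if "1 \<le> k" "k \<le> ?N" for k
    proof -
      have "r k z = 0" using rz that by auto
      then show ?thesis by (simp add: r_def a)
    qed
    define T where "T = mat n n (\<lambda>(l, i). if l < ?N \<and> i < ?N then a i l else if l = i then 1 else 0)"
    have T: "T \<in> Ps n (Smat \<nu>)"
      unfolding T_def by (rule symplectic_extension_in_Ps) (rule symplectic_from_pairing[OF pair])
    have carrier: "T \<in> carrier_mat n n" by (simp add: T_def)
    have image: "var_image T i = (if i < ?N then z i else Xvar i)" for i
    proof (cases "i < n")
      case False
      then show ?thesis using carrier n by (simp add: var_image_def)
    next
      case True
      have "linform n (\<lambda>l. T $$ (l, i)) = linform ?N (\<lambda>l. T $$ (l, i)) + Const (T $$ (?N, i)) * Xvar ?N"
        by (simp add: linform_def sum_dim_split)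
      moreover have "linform ?N (\<lambda>l. T $$ (l, i)) = (if i < ?N then z i else 0)"
        using n True by (auto simp: linform_def T_def a Const.c_zero)
      moreover have "Const (T $$ (?N, i)) * Xvar ?N = (if i < ?N then 0 else Xvar i)"
        using n True by (auto simp: T_def Const.c_zero Const.c_one less_Suc_eq)
      ultimately show ?thesis using True by (simp add: var_image_linform[OF carrier])
    qed
    have "g z = mpol_eval Const (var_image T) p" by (simp add: g_def image[abs_def])
    also have "\<dots> = g Xvar" by (simp add: gX inv[OF T] flip: to_fract_act)
    finally show "g z = g Xvar" .
  qed (use dK reduction g finite_linforms in auto)
  then show ?thesis by (simp add: gX K_def)
qed

end

theorem theorem4p1:
  fixes \<nu> n :: nat
  assumes "CHAR('a :: {field, finite}) = 2" and "\<nu> \<ge> 1" and "n = 2 * \<nu> + 1"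
  shows "invariant_field n (Ps n (Smat \<nu> :: 'a mat)) =
         adjoin (Ppol \<nu> ` {1..n - 1} \<union> {Xvar (n - 1)})"
proof
  have "of_nat (CHAR('a)) = (0 :: 'a)" by (rule of_nat_CHAR)
  then have char: "(1 :: 'a) + 1 = 0" using assms(1) by simp
  show "invariant_field n (Ps n (Smat \<nu> :: 'a mat)) \<subseteq> adjoin (Ppol \<nu> ` {1..n - 1} \<union> {Xvar (n - 1)})"
  proof (rule invariants_from_polynomial_invariants)
    show "Ps n (Smat \<nu> :: 'a mat) \<subseteq> GL n" by (auto simp: Ps_def)
  qed (use Ps_one[OF assms(3)] Ps_mult[OF assms(3)] adjoin_subfield
      invariant_polynomial_in_adjoin[OF assms(3) char] in auto)
  show "adjoin (Ppol \<nu> ` {1..n - 1} \<union> {Xvar (n - 1)}) \<subseteq> invariant_field n (Ps n (Smat \<nu> :: 'a mat))"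
    by (rule adjoin_generators_invariant[OF assms(3) char])
qed

end
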